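(* For all integers $n\geq 0$, the following two congruences hold: \begin{align*} \sum_{k\geq 0} a\left(25n+16-\frac{5k(k+1)}{2}\right)&\equiv 0\pmod{5},\\ \frac{1}{5}\sum_{k\geq 0} C\left(125n+114-\frac{5k(k+1)}{2}\right)&\equiv 0\pmod{25}. \end{align*} Here $k$ runs over all nonnegative integers, and $a(m)=C(m)=0$ for every integer $m<0$, so both sums are finite.
   Context: For a positive integer $m$ let $f_m := \prod_{j\geq 1}(1-q^{mj})$, where $|q|<1$ (equivalently, as a formal power series in $q$). The integer sequences $C(n)$ and $a(n)$, $n\ge 0$, are defined by the generating functions $$\sum_{n\geq 0} C(n)q^n = \frac{f_1^3}{f_2^2},\qquad \sum_{n\geq 0} a(n)q^n = \frac{f_2^2}{f_1^3},$$ and are extended by $C(m)=a(m)=0$ for integers $m<0$. ($C(n)$ is the crank parity function: the number of partitions of $n$ with even crank minus the number with odd crank, with the usual generating-function convention for small $n$.) It is known that $C(5m+4)\equiv 0\pmod 5$ for all $m\ge 0$, so the left-hand side of the second congruence is an integer. *)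

theory Defs
  imports "HOL-Analysis.Analysis" "HOL-Number_Theory.Cong"
begin

text \<open>
  All generating functions are formal power series over \<open>int\<close>, with their standard topology of
  coefficientwise stabilization; the infinite product is the library's \<open>prodinf\<close>. Its index
  starts at \<open>0\<close>, hence \<open>Suc j\<close>.
\<close>

definition euler_f :: "nat \<Rightarrow> int fps" where
  "euler_f m = (\<Prod>j. 1 - fps_X ^ (m * Suc j))"

text \<open>
  Since \<open>int\<close> has no \<open>inverse\<close>, neither has \<open>int fps\<close>. The expression
  \<open>fps_right_inverse g 1\<close> is the inverse of a series \<open>g\<close> with constant coefficient \<open>1\<close>.
\<close>

definition C :: "int \<Rightarrow> int" where
  "C n = (if n < 0 then 0
          else fps_nth (euler_f 1 ^ 3 * fps_right_inverse (euler_f 2 ^ 2) 1) (nat n))"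

definition a :: "int \<Rightarrow> int" where
  "a n = (if n < 0 then 0
          else fps_nth (euler_f 2 ^ 2 * fps_right_inverse (euler_f 1 ^ 3) 1) (nat n))"

text \<open>The product defining \<open>euler_f\<close> converges, and the two quotients are genuine quotients.\<close>

lemma
  assumes "m > 0"
  shows has_prod_euler_f: "(\<lambda>j. 1 - fps_X ^ (m * Suc j)) has_prod euler_f m"
    and euler_f_nth_0: "fps_nth (euler_f m) 0 = 1"
proof -
  define f :: "nat \<Rightarrow> int fps" where "f = (\<lambda>j. 1 - fps_X ^ (m * Suc j))"
  have f0: "fps_nth (f j) 0 = 1" for j
    using assms by (simp add: f_def)
  have "f j \<noteq> 0" for j
    using f0[of j] by auto
  moreover have "subdegree (f k - 1) > n" if "k > n" for n k
  proof -
    have "f k - 1 = - (fps_X ^ (m * Suc k))"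
      by (simp add: f_def)
    hence "subdegree (f k - 1) = m * Suc k"
      by (simp del: mult_Suc_right)
    moreover have "Suc k \<le> m * Suc k"
      using assms by (simp del: mult_Suc_right)
    ultimately show ?thesis
      using that by linarith
  qed
  ultimately obtain P where P: "(\<lambda>n. \<Prod>k\<le>n. f k) \<longlonglongrightarrow> P"
    using tendsto_prod_fps[of f "\<lambda>n. n"] by blast
  have prod0: "fps_nth (\<Prod>k\<le>n. f k) 0 = 1" for n
    by (induction n) (simp_all add: f0)
  have "\<forall>\<^sub>F n in sequentially. fps_nth (\<Prod>k\<le>n. f k) 0 = fps_nth P 0"
    using P by (simp only: tendsto_fps_iff)
  hence P0: "fps_nth P 0 = 1"
    by (simp add: prod0)
  hence "P \<noteq> 0"
    by auto
  with P have hp: "f has_prod P"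
    by (simp add: has_prod_def raw_has_prod_def)
  hence "P = euler_f m"
    using has_prod_unique[OF hp] by (simp only: euler_f_def f_def)
  with hp P0 show "(\<lambda>j. 1 - fps_X ^ (m * Suc j)) has_prod euler_f m"
    and "fps_nth (euler_f m) 0 = 1"
    by (simp_all only: f_def)
qed

lemma C_gen_fun: "Abs_fps (\<lambda>n. C (int n)) * euler_f 2 ^ 2 = euler_f 1 ^ 3"
proof -
  define R where "R = fps_right_inverse (euler_f 2 ^ 2) 1"
  have "euler_f 2 ^ 2 * R = 1"
    unfolding R_def by (rule fps_right_inverse) (simp add: euler_f_nth_0 fps_nth_power_0)
  hence "euler_f 1 ^ 3 * R * euler_f 2 ^ 2 = euler_f 1 ^ 3"
    by (simp add: mult.assoc mult.commute[of R])
  moreover have "Abs_fps (\<lambda>n. C (int n)) = euler_f 1 ^ 3 * R"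
    unfolding R_def by (simp add: C_def fps_eq_iff)
  ultimately show ?thesis
    by simp
qed

lemma a_gen_fun: "Abs_fps (\<lambda>n. a (int n)) * euler_f 1 ^ 3 = euler_f 2 ^ 2"
proof -
  define R where "R = fps_right_inverse (euler_f 1 ^ 3) 1"
  have "euler_f 1 ^ 3 * R = 1"
    unfolding R_def by (rule fps_right_inverse) (simp add: euler_f_nth_0 fps_nth_power_0)
  hence "euler_f 2 ^ 2 * R * euler_f 1 ^ 3 = euler_f 2 ^ 2"
    by (simp add: mult.assoc mult.commute[of R])
  moreover have "Abs_fps (\<lambda>n. a (int n)) = euler_f 2 ^ 2 * R"
    unfolding R_def by (simp add: a_def fps_eq_iff)
  ultimately show ?thesis
    by simp
qed

text \<open>
  A series of integers with finitely many nonzero terms is summed by \<open>suminf\<close> to its finite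
  sum; the following shows that the sums over all \<open>k \<ge> 0\<close> of interest are of this kind.
\<close>

lemma suminf_triangular_shift:
  fixes g :: "int \<Rightarrow> int"
  assumes "\<And>i. i < 0 \<Longrightarrow> g i = 0"
  shows "(\<Sum>k. g (int N - 5 * int k * (int k + 1) div 2)) =
         (\<Sum>k\<le>N. g (int N - 5 * int k * (int k + 1) div 2))"
proof (rule suminf_finite)
  fix k assume "k \<notin> {..N}"
  hence k: "int N + 1 \<le> int k" "int k \<ge> 1"
    by auto
  have "int k * 2 \<le> int k * (int k + 1)"
    using k by (intro mult_left_mono) auto
  hence "5 * int k * (int k + 1) div 2 \<ge> int k"
    by linarith
  thus "g (int N - 5 * int k * (int k + 1) div 2) = 0"
    using k by (intro assms) linarith
qed simp

end

theory Submission
  imports Defs "HOL-Computational_Algebra.Polynomial_Factorial"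
begin

text \<open>
  Write \<open>f\<^sub>m = euler_f m\<close>, \<open>\<psi> = f\<^sub>2\<^sup>2 / f\<^sub>1\<close> (the generating function of the triangular numbers) and
  \<open>\<phi> = f\<^sub>1\<^sup>2 / f\<^sub>2\<close>. The two sums are coefficients of \<open>\<psi>(q\<^sup>5) f\<^sub>2\<^sup>2 / f\<^sub>1\<^sup>3\<close> and \<open>F = \<psi>(q\<^sup>5) f\<^sub>1\<^sup>3 / f\<^sub>2\<^sup>2\<close>.

  Modulo 5 the first series is \<open>\<psi> f\<^sub>1\<^sup>3 \<psi>(q\<^sup>5) / f\<^sub>5\<close>. The form \<open>\<psi> f\<^sub>1\<^sup>3\<close> is an eigenform of the Hecke operator at 5 with
  eigenvalue \<open>-2\<close> modulo 5 (multiplication by the Gaussian integers \<open>2 \<plusminus> i\<close>), so extracting the exponents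
  \<open>5 n + 1\<close> leaves \<open>-2 f\<^sub>2\<^sup>4\<close>, whose coefficients at \<open>5 n + 3\<close> vanish modulo 5 by Ramanujan's argument for \<open>f\<^sub>1\<^sup>4\<close>.

  For the second series, \<open>f\<^sub>1\<^sup>3 / f\<^sub>2\<^sup>2 = \<phi>\<^sup>2 / f\<^sub>1\<close>, and the 5-dissections of \<open>\<phi>\<close> and \<open>f\<^sub>1\<close> give
  \<open>\<Sum> C(5 n + 4) q\<^sup>n = 5 f\<^sub>1\<^sup>2 f\<^sub>5 f\<^sub>1\<^sub>0\<^sup>2 / f\<^sub>2\<^sup>4\<close>. Hence the exponents \<open>5 n + 4\<close> of \<open>F\<close> carry \<open>5 f\<^sub>5 f\<^sub>1\<^sub>0\<^sup>2 / \<psi>\<close>. The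
  5-dissection of \<open>1 / \<psi>\<close> turns the exponents \<open>5 n + 2\<close> of this into \<open>5 F\<close> plus two corrections with a factor
  \<open>25\<close>, and at the exponents \<open>5 n + 4\<close> the three contributions cancel modulo 125.
\<close>

section \<open>Reciprocals and congruences of power series\<close>

definition inv_fps :: "int fps \<Rightarrow> int fps" where
  "inv_fps g = fps_right_inverse g 1"

lemma inv_fps: "fps_nth g 0 = 1 \<Longrightarrow> g * inv_fps g = 1"
  unfolding inv_fps_def by (rule fps_right_inverse) simp

lemma inv_fps_nth_0 [simp]: "fps_nth g 0 = 1 \<Longrightarrow> fps_nth (inv_fps g) 0 = 1"
  using arg_cong[OF inv_fps[of g], of "\<lambda>f. fps_nth f 0"] by simp

text \<open>Divisibility by \<open>fps_X ^ n\<close> encodes agreement of the first \<open>n\<close>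
  coefficients. Infinite products and theta series are compared through such congruences, which are
  stable under sums and products.\<close>

lemma fps_X_power_dvd_iff:
  fixes f :: "'a :: comm_ring_1 fps"
  shows "fps_X ^ n dvd f \<longleftrightarrow> (\<forall>k<n. fps_nth f k = 0)"
proof
  assume "fps_X ^ n dvd f"
  thus "\<forall>k<n. fps_nth f k = 0" by (auto simp: fps_X_power_mult_nth)
next
  assume "\<forall>k<n. fps_nth f k = 0"
  hence "f = fps_X ^ n * fps_shift n f"
    by (auto simp: fps_eq_iff fps_X_power_mult_nth)
  thus "fps_X ^ n dvd f" by (rule dvdI)
qed

lemma fps_eq_if_X_power_dvd:
  fixes f :: "'a :: comm_ring_1 fps"
  assumes "\<And>n. fps_X ^ n dvd f - g"
  shows "f = g"
proof (rule fps_ext)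
  fix n
  show "fps_nth f n = fps_nth g n"
    using assms[of "Suc n"] unfolding fps_X_power_dvd_iff by (auto dest: spec[of _ n])
qed

lemma dvd_diff_mult:
  fixes a b c d m :: "'a :: comm_ring_1"
  assumes "m dvd a - b" "m dvd c - d"
  shows "m dvd a * c - b * d"
proof -
  have "a * c - b * d = (a - b) * c + b * (c - d)" by (simp add: algebra_simps)
  thus ?thesis using assms by simp
qed

section \<open>Gaussian binomial coefficients\<close>

text \<open>The q-Pochhammer symbol with base and argument \<open>q^d\<close>, a truncation of
  \<open>euler_f d\<close>.\<close>

definition fin_euler :: "nat \<Rightarrow> nat \<Rightarrow> int fps" where
  "fin_euler d n = (\<Prod>j<n. 1 - fps_X ^ (d * Suc j))"

lemma fin_euler_0 [simp]: "fin_euler d 0 = 1"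
  by (simp add: fin_euler_def)

lemma fin_euler_Suc: "fin_euler d (Suc n) = fin_euler d n * (1 - fps_X ^ (d * Suc n))"
  by (simp add: fin_euler_def)

lemma fin_euler_nth_0 [simp]: "d > 0 \<Longrightarrow> fps_nth (fin_euler d n) 0 = 1"
  by (induction n) (simp_all add: fin_euler_Suc)

lemma fin_euler_tail:
  assumes "d > 0" "n \<le> m"
  shows "fps_X ^ n dvd fin_euler d m - fin_euler d n"
  using assms(2)
proof (induction m rule: dec_induct)
  case (step m)
  have "fin_euler d (Suc m) - fin_euler d n =
      (fin_euler d m - fin_euler d n) - fin_euler d m * fps_X ^ (d * Suc m)"
    by (simp add: fin_euler_Suc algebra_simps)
  moreover have "n \<le> d * Suc m"
    using step(1) mult_le_mono1[of 1 d "Suc m"] assms(1) by simp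
  hence "fps_X ^ n dvd fin_euler d m * fps_X ^ (d * Suc m)"
    by (intro dvd_mult le_imp_power_dvd)
  ultimately show ?case using step.IH by (simp only: dvd_diff)
qed simp

lemma euler_f_approx:
  assumes "d > 0"
  shows "fps_X ^ n dvd euler_f d - fin_euler d n"
  unfolding fps_X_power_dvd_iff
proof safe
  fix k assume k: "k < n"
  have "(\<lambda>m. \<Prod>j\<le>m. 1 - fps_X ^ (d * Suc j)) \<longlonglongrightarrow> euler_f d"
    by (rule has_prod_imp_tendsto[OF has_prod_euler_f[OF assms]])
  hence "\<forall>\<^sub>F m in sequentially. fps_nth (\<Prod>j\<le>m. 1 - fps_X ^ (d * Suc j)) k = fps_nth (euler_f d) k"
    by (simp only: tendsto_fps_iff)
  then obtain m where m: "m \<ge> n"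
      "fps_nth (\<Prod>j\<le>m. 1 - fps_X ^ (d * Suc j)) k = fps_nth (euler_f d) k"
    unfolding eventually_sequentially by (meson nat_le_linear)
  have "fps_nth (fin_euler d (Suc m)) k = fps_nth (fin_euler d n) k"
    using fin_euler_tail[OF assms, of n "Suc m"] m(1) k unfolding fps_X_power_dvd_iff by auto
  with m(2) show "fps_nth (euler_f d - fin_euler d n) k = 0"
    by (simp add: fin_euler_def lessThan_Suc_atMost)
qed

lemma inv_fps_cong:
  assumes "m dvd f - g" "fps_nth f 0 = 1" "fps_nth g 0 = 1"
  shows "m dvd inv_fps f - inv_fps g"
proof -
  have "inv_fps f - inv_fps g = (inv_fps f * inv_fps g) * (g - f)"
    using inv_fps[OF assms(2)] inv_fps[OF assms(3)] by algebra
  thus ?thesis using assms(1) by (metis dvd_mult dvd_minus_iff minus_diff_eq)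
qed

text \<open>
  The reciprocal of \<open>fin_euler\<close>, extended by \<open>0\<close> to negative indices; the recurrence
  \<open>(1 - Q ^ m) / (Q)_m = 1 / (Q)_(m-1)\<close> then holds for \<open>m = 0\<close> as well.
\<close>

definition rec_euler :: "nat \<Rightarrow> int \<Rightarrow> int fps" where
  "rec_euler d m = (if m < 0 then 0 else inv_fps (fin_euler d (nat m)))"

lemma rec_euler_pred:
  assumes "d > 0"
  shows "rec_euler d (int m - 1) = rec_euler d (int m) * (1 - fps_X ^ (d * m))"
proof (cases m)
  case 0
  thus ?thesis by (simp add: rec_euler_def)
next
  case (Suc k)
  have 1: "fin_euler d k * inv_fps (fin_euler d k) = 1"
    "fin_euler d (Suc k) * inv_fps (fin_euler d (Suc k)) = 1"
    using assms by (intro inv_fps; simp)+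
  have *: "x = y * c" if "e * x = 1" "e * c * y = 1" for e x y c :: "int fps"
    using that by algebra
  have "inv_fps (fin_euler d k) = inv_fps (fin_euler d (Suc k)) * (1 - fps_X ^ (d * Suc k))"
    by (rule *[OF 1[unfolded fin_euler_Suc], folded fin_euler_Suc])
  thus ?thesis by (simp add: Suc rec_euler_def nat_add_distrib)
qed

text \<open>The Gaussian binomial coefficient of \<open>2 n\<close> over \<open>n + i\<close> in the base \<open>q\<^sup>d\<close>, zero for \<open>\<bar>i\<bar> > n\<close>.\<close>

definition qbin :: "nat \<Rightarrow> nat \<Rightarrow> int \<Rightarrow> int fps" where
  "qbin d n i = fin_euler d (2 * n) * rec_euler d (int n + i) * rec_euler d (int n - i)"

lemma qbin_eq_0: "i < - int n \<or> i > int n \<Longrightarrow> qbin d n i = 0"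
  by (auto simp: qbin_def rec_euler_def)

text \<open>Two applications of the q-Pascal rule, centred so that the top grows by 2 and the offset
  \<open>i\<close> stays. In terms of the reciprocals at \<open>s = n + 1 + i\<close> and
  \<open>t = n + 1 - i\<close> the claim is a polynomial identity.\<close>

lemma qbin_Suc:
  assumes d: "d > 0" and i: "- int n - 1 \<le> i" "i \<le> int n + 1"
  shows "qbin d (Suc n) i = (1 + fps_X ^ (d * (2 * n + 1))) * qbin d n i
     + fps_X ^ (d * nat (int n + 1 - i)) * qbin d n (i - 1)
     + fps_X ^ (d * nat (int n + 1 + i)) * qbin d n (i + 1)"
proof -
  define s t where "s = nat (int n + 1 + i)" and "t = nat (int n + 1 - i)"
  define A B Q v w where "A = (fps_X ^ (d * s) :: int fps)" and "B = (fps_X ^ (d * t) :: int fps)"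
    and "Q = (fps_X ^ d :: int fps)" and "v = rec_euler d (int s)" and "w = rec_euler d (int t)"
  have st: "int n + i = int s - 1" "int n - i = int t - 1" "int n + (i - 1) = int s - 2"
      "int n - (i + 1) = int t - 2" "int n + (i + 1) = int s" "int n - (i - 1) = int t"
      "int (Suc n) + i = int s" "int (Suc n) - i = int t" and st2: "s + t = 2 * n + 2"
    using i by (auto simp: s_def t_def)
  have pred1: "rec_euler d (int m - 1) = rec_euler d (int m) * (1 - fps_X ^ (d * m))" for m
    by (rule rec_euler_pred[OF d])
  \<comment> \<open>The factor \<open>Q\<close> avoids the exponent \<open>d * (m - 1)\<close>. For
    \<open>m = 0\<close> the factor \<open>1 - fps_X ^ (d * m)\<close> is zero, as is the left
    side.\<close>
  have pred2: "Q * rec_euler d (int m - 2)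
      = rec_euler d (int m) * (1 - fps_X ^ (d * m)) * (Q - fps_X ^ (d * m))" for m
  proof (cases m)
    case 0
    thus ?thesis by (simp add: rec_euler_def)
  next
    case (Suc r)
    have "Q * rec_euler d (int r - 1) = rec_euler d (int r) * (Q - Q * fps_X ^ (d * r))"
      unfolding pred1[of r] by (simp add: algebra_simps)
    also have "Q * fps_X ^ (d * r) = fps_X ^ (d * m)"
      by (simp add: Suc Q_def power_add)
    also have "rec_euler d (int r) = rec_euler d (int m) * (1 - fps_X ^ (d * m))"
      using pred1[of m] Suc by simp
    finally show ?thesis using Suc by (simp add: algebra_simps)
  qed
  have v1: "rec_euler d (int n + i) = v * (1 - A)"
    unfolding st v_def A_def by (rule pred1)
  have w1: "rec_euler d (int n - i) = w * (1 - B)"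
    unfolding st w_def B_def by (rule pred1)
  have v2: "Q * rec_euler d (int n + (i - 1)) = v * (1 - A) * (Q - A)"
    unfolding st v_def A_def by (rule pred2)
  have w2: "Q * rec_euler d (int n - (i + 1)) = w * (1 - B) * (Q - B)"
    unfolding st w_def B_def by (rule pred2)
  have v0: "rec_euler d (int n + (i + 1)) = v" "rec_euler d (int n - (i - 1)) = w"
    "rec_euler d (int (Suc n) + i) = v" "rec_euler d (int (Suc n) - i) = w"
    unfolding st v_def w_def by (rule refl)+
  have AB: "A * B = Q * fps_X ^ (d * (2 * n + 1))"
    using st2 by (simp add: A_def B_def Q_def power_add[symmetric] add_mult_distrib2[symmetric])
  define R where "R = (fps_X ^ (d * (2 * n + 1)) :: int fps)"
  have e: "fin_euler d (2 * Suc n) = fin_euler d (2 * n) * (1 - R) * (1 - Q * R)"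
  proof -
    have "2 * Suc n = Suc (Suc (2 * n))" "d * Suc (2 * n) = d * (2 * n + 1)"
      "d * Suc (Suc (2 * n)) = d + d * (2 * n + 1)" by simp_all
    thus ?thesis by (simp only: fin_euler_Suc R_def Q_def power_add)
  qed
  have "Q * qbin d (Suc n) i = Q * ((1 + R) * qbin d n i + B * qbin d n (i - 1) + A * qbin d n (i + 1))"
    unfolding qbin_def v0 v1 w1 e using v2 w2 AB[folded R_def] by algebra
  moreover have "Q \<noteq> 0" by (simp add: Q_def)
  ultimately show ?thesis
    by (simp add: R_def A_def B_def s_def t_def)
qed

text \<open>Moves the recurrence from the binomials to an arbitrary family \<open>g\<close> by
  shifting the index; the ranges can be adjusted because \<open>qbin\<close> vanishes outside them.
  It serves both the triple product and its weighted version in \<open>theta_cube\<close>.\<close>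

lemma qbin_sum_Suc:
  assumes d: "d > 0"
  shows "(\<Sum>i=-int (Suc n)..int (Suc n). g i * qbin d (Suc n) i) =
    (\<Sum>i=-int n..int n. ((1 + fps_X ^ (d * (2 * n + 1))) * g i
       + fps_X ^ (d * nat (int n - i)) * g (i + 1)
       + fps_X ^ (d * nat (int n + i)) * g (i - 1)) * qbin d n i)"
proof -
  let ?I = "{-int (Suc n)..int (Suc n)}" and ?J = "{-int n..int n}"
  have ext: "(\<Sum>i\<in>?J. k i * qbin d n i) = (\<Sum>i\<in>K. k i * qbin d n i)"
    if "finite K" "?J \<subseteq> K" for K and k :: "int \<Rightarrow> int fps"
    using that by (intro sum.mono_neutral_left) (auto simp: qbin_eq_0 not_le)
  have "(\<Sum>i\<in>?I. g i * qbin d (Suc n) i) =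
      (\<Sum>i\<in>?I. (1 + fps_X ^ (d * (2 * n + 1))) * g i * qbin d n i)
      + (\<Sum>i\<in>?I. fps_X ^ (d * nat (int n + 1 - i)) * g i * qbin d n (i - 1))
      + (\<Sum>i\<in>?I. fps_X ^ (d * nat (int n + 1 + i)) * g i * qbin d n (i + 1))"
    unfolding sum.distrib[symmetric]
    by (intro sum.cong refl, subst qbin_Suc[OF d]) (auto simp: algebra_simps)
  also have "(\<Sum>i\<in>?I. fps_X ^ (d * nat (int n + 1 - i)) * g i * qbin d n (i - 1)) =
      (\<Sum>i\<in>(\<lambda>i. i - 1) ` ?I. fps_X ^ (d * nat (int n - i)) * g (i + 1) * qbin d n i)"
    by (subst sum.reindex) (auto simp: inj_on_def algebra_simps)
  also have "\<dots> = (\<Sum>i\<in>?J. fps_X ^ (d * nat (int n - i)) * g (i + 1) * qbin d n i)"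
    by (rule ext[symmetric]) (auto simp: image_iff intro!: bexI[of _ "_ + 1"])
  also have "(\<Sum>i\<in>?I. fps_X ^ (d * nat (int n + 1 + i)) * g i * qbin d n (i + 1)) =
      (\<Sum>i\<in>(\<lambda>i. i + 1) ` ?I. fps_X ^ (d * nat (int n + i)) * g (i - 1) * qbin d n i)"
    by (subst sum.reindex) (auto simp: inj_on_def algebra_simps)
  also have "\<dots> = (\<Sum>i\<in>?J. fps_X ^ (d * nat (int n + i)) * g (i - 1) * qbin d n i)"
    by (rule ext[symmetric]) (auto simp: image_iff intro!: bexI[of _ "_ - 1"])
  also have "(\<Sum>i\<in>?I. (1 + fps_X ^ (d * (2 * n + 1))) * g i * qbin d n i) =
      (\<Sum>i\<in>?J. (1 + fps_X ^ (d * (2 * n + 1))) * g i * qbin d n i)"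
    by (rule ext[symmetric]) auto
  finally show ?thesis
    by (simp add: sum.distrib distrib_right)
qed

text \<open>As \<open>n\<close> grows, the binomial tends to the reciprocal of
  \<open>euler_f d\<close>. All indices of \<open>fin_euler\<close> involved are at least
  \<open>n - nat \<bar>i\<bar>\<close>, which gives the rate.\<close>

lemma qbin_approx:
  assumes d: "d > 0" and i: "nat \<bar>i\<bar> \<le> n"
  shows "fps_X ^ (n - nat \<bar>i\<bar>) dvd qbin d n i * fin_euler d n - 1"
proof -
  define N where "N = n - nat \<bar>i\<bar>"
  have fe: "fps_X ^ N dvd fin_euler d m - euler_f d" if "m \<ge> N" for m
  proof -
    have "fps_X ^ m dvd euler_f d - fin_euler d m" by (rule euler_f_approx[OF d])
    moreover have "(fps_X :: int fps) ^ N dvd fps_X ^ m" using that by (rule le_imp_power_dvd)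
    ultimately have "fps_X ^ N dvd euler_f d - fin_euler d m" by (rule dvd_trans[rotated])
    thus ?thesis by (metis dvd_minus_iff minus_diff_eq)
  qed
  have re: "fps_X ^ N dvd rec_euler d m - inv_fps (euler_f d)" if "m \<ge> int N" for m
    using that d unfolding rec_euler_def
    by (auto intro!: inv_fps_cong fe simp: euler_f_nth_0)
  have "fps_X ^ N dvd qbin d n i * fin_euler d n
      - euler_f d * inv_fps (euler_f d) * inv_fps (euler_f d) * euler_f d"
    unfolding qbin_def using i by (intro dvd_diff_mult fe re) (auto simp: N_def)
  also have "euler_f d * inv_fps (euler_f d) * inv_fps (euler_f d) * euler_f d = 1"
    using inv_fps[OF euler_f_nth_0[OF d]] by algebra
  finally show ?thesis by (simp add: N_def)
qed

section \<open>The triple product and Jacobi's identity\<close>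

text \<open>The two-sided series of \<open>c i * q ^ e i\<close> over all integers \<open>i\<close>.
  A sum over an infinite fibre of \<open>e\<close> would default to 0; the growth condition in
  \<open>theta_approx\<close> makes all fibres finite.\<close>

definition theta :: "(int \<Rightarrow> int) \<Rightarrow> (int \<Rightarrow> nat) \<Rightarrow> int fps" where
  "theta c e = Abs_fps (\<lambda>n. \<Sum>i | e i = n. c i)"

text \<open>The error of the term at \<open>i\<close> is divisible by
  \<open>fps_X ^ (e i + (n - nat \<bar>i\<bar>))\<close>, and the growth condition makes this
  exponent at least \<open>n - 1\<close>. The same condition keeps indices beyond \<open>n\<close>
  from contributing below \<open>n - 1\<close>.\<close>

lemma theta_approx:
  assumes d: "d > 0" and e: "\<And>i. \<bar>i\<bar> \<le> int (e i) + 1"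
  shows "fps_X ^ (n - 1) dvd
    (\<Sum>i=-int n..int n. fps_const (c i) * fps_X ^ e i * qbin d n i) * fin_euler d n - theta c e"
proof -
  let ?I = "{-int n..int n}"
  have "fps_X ^ (n - 1) dvd
      (\<Sum>i\<in>?I. fps_const (c i) * fps_X ^ e i * (qbin d n i * fin_euler d n - 1))"
  proof (intro dvd_sum)
    fix i assume i: "i \<in> ?I"
    hence le: "nat \<bar>i\<bar> \<le> n" by auto
    have "fps_X ^ (n - nat \<bar>i\<bar>) dvd qbin d n i * fin_euler d n - 1"
      by (rule qbin_approx[OF d le])
    hence "fps_X ^ (e i + (n - nat \<bar>i\<bar>)) dvd fps_X ^ e i * (qbin d n i * fin_euler d n - 1)"
      unfolding power_add by (intro mult_dvd_mono) auto
    moreover have "(fps_X :: int fps) ^ (n - 1) dvd fps_X ^ (e i + (n - nat \<bar>i\<bar>))"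
      using e[of i] le by (intro le_imp_power_dvd) linarith
    ultimately show "fps_X ^ (n - 1) dvd
        fps_const (c i) * fps_X ^ e i * (qbin d n i * fin_euler d n - 1)"
      by (metis dvd_mult dvd_trans mult.assoc)
  qed
  moreover have "fps_X ^ (n - 1) dvd (\<Sum>i\<in>?I. fps_const (c i) * fps_X ^ e i) - theta c e"
    unfolding fps_X_power_dvd_iff
  proof safe
    fix k assume k: "k < n - 1"
    have "(\<Sum>i\<in>?I. fps_nth (fps_const (c i) * fps_X ^ e i) k) = (\<Sum>i\<in>?I. if e i = k then c i else 0)"
      by (intro sum.cong) auto
    also have "\<dots> = (\<Sum>i | i \<in> ?I \<and> e i = k. c i)"
      by (simp add: sum.inter_filter[symmetric])
    also have "{i. i \<in> ?I \<and> e i = k} = {i. e i = k}"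
    proof -
      have "i \<in> ?I" if "e i = k" for i
        using e[of i] k that by auto
      thus ?thesis by blast
    qed
    finally show "fps_nth ((\<Sum>i\<in>?I. fps_const (c i) * fps_X ^ e i) - theta c e) k = 0"
      by (simp add: theta_def fps_sum_nth)
  qed
  ultimately have "fps_X ^ (n - 1) dvd
     (\<Sum>i\<in>?I. fps_const (c i) * fps_X ^ e i * (qbin d n i * fin_euler d n - 1))
     + ((\<Sum>i\<in>?I. fps_const (c i) * fps_X ^ e i) - theta c e)"
    by (rule dvd_add)
  also have "\<dots> = (\<Sum>i\<in>?I. fps_const (c i) * fps_X ^ e i * qbin d n i) * fin_euler d n - theta c e"
    by (simp add: sum_distrib_right right_diff_distrib sum_subtractf mult.assoc)
  finally show ?thesis .
qed

text \<open>
  For \<open>a = s q\<^sup>\<alpha>\<close> and \<open>b = s q\<^sup>\<beta>\<close> with \<open>s = \<plusminus> 1\<close>, the term \<open>a ^ (i (i + 1) / 2) b ^ (i (i - 1) / 2)\<close> of Ramanujan's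
  theta function equals \<open>tsgn s i * q ^ texp \<alpha> \<beta> i\<close>.
\<close>

definition texp :: "nat \<Rightarrow> nat \<Rightarrow> int \<Rightarrow> nat" where
  "texp \<alpha> \<beta> i = nat ((int \<alpha> * (i * (i + 1)) + int \<beta> * (i * (i - 1))) div 2)"

lemma texp: "2 * int (texp \<alpha> \<beta> i) = int \<alpha> * (i * (i + 1)) + int \<beta> * (i * (i - 1))"
proof -
  have 1: "i * (i + 1) \<ge> 0" "i * (i - 1) \<ge> 0"
    by (auto simp: zero_le_mult_iff)
  have "even (int \<alpha> * (i * (i + 1)) + int \<beta> * (i * (i - 1)))"
    by auto
  moreover have "int \<alpha> * (i * (i + 1)) + int \<beta> * (i * (i - 1)) \<ge> 0"
    by (intro add_nonneg_nonneg mult_nonneg_nonneg[OF _ 1(1)] mult_nonneg_nonneg[OF _ 1(2)]) auto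
  ultimately show ?thesis
    unfolding texp_def by (auto elim!: evenE)
qed

text \<open>With \<open>t = \<bar>i\<bar>\<close>, both \<open>i * (i + 1)\<close> and
  \<open>i * (i - 1)\<close> are at least \<open>t * (t - 1)\<close>, which is at least
  \<open>2 * (t - 1)\<close> because \<open>(t - 1) * (t - 2) \<ge> 0\<close>.\<close>

lemma texp_ge:
  assumes "\<alpha> + \<beta> > 0"
  shows "\<bar>i\<bar> \<le> int (texp \<alpha> \<beta> i) + 1"
proof -
  define t where "t = \<bar>i\<bar>"
  have t: "t \<ge> 0" "i * i = t * t" "i = t \<or> i = - t"
    by (auto simp: t_def abs_if)
  have 0: "t * (t - 1) \<ge> 0" using t(1) by (auto simp: zero_le_mult_iff)
  have "t * (t - 1) \<le> i * (i + 1)" "t * (t - 1) \<le> i * (i - 1)"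
    using t by (auto simp: algebra_simps)
  hence "int \<alpha> * (t * (t - 1)) + int \<beta> * (t * (t - 1)) \<le> 2 * int (texp \<alpha> \<beta> i)"
    unfolding texp by (intro add_mono mult_left_mono) auto
  moreover have "1 * (t * (t - 1)) \<le> (int \<alpha> + int \<beta>) * (t * (t - 1))"
    using assms 0 by (intro mult_right_mono) auto
  moreover have "(t - 1) * (t - 2) \<ge> 0"
    by (auto simp: zero_le_mult_iff)
  ultimately show ?thesis
    by (simp add: algebra_simps flip: t_def)
qed

definition tsgn :: "int \<Rightarrow> int \<Rightarrow> int" where
  "tsgn s i = (if even i then 1 else s)"

abbreviation tterm :: "int \<Rightarrow> nat \<Rightarrow> nat \<Rightarrow> int \<Rightarrow> int fps" where
  "tterm s \<alpha> \<beta> i \<equiv> fps_const (tsgn s i) * fps_X ^ texp \<alpha> \<beta> i"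

lemma double_int_eqD: "2 * int m = 2 * int n \<Longrightarrow> m = n"
  by simp

text \<open>The power on the left is the coefficient at \<open>g (i + 1)\<close> in
  \<open>qbin_sum_Suc\<close>. The shift of the theta term cancels its dependence on
  \<open>i\<close>, so the remaining factor is the same for all \<open>i\<close>.\<close>

lemma tterm_succ:
  assumes s: "s * s = 1" and i: "i \<le> int n"
  shows "fps_X ^ ((\<alpha> + \<beta>) * nat (int n - i)) * tterm s \<alpha> \<beta> (i + 1)
    = fps_const s * fps_X ^ (\<alpha> + (\<alpha> + \<beta>) * n) * tterm s \<alpha> \<beta> i"
proof -
  have "2 * int ((\<alpha> + \<beta>) * nat (int n - i) + texp \<alpha> \<beta> (i + 1))
      = 2 * int (\<alpha> + (\<alpha> + \<beta>) * n + texp \<alpha> \<beta> i)"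
    using i texp[of \<alpha> \<beta> i] texp[of \<alpha> \<beta> "i + 1"] by (simp add: algebra_simps)
  from double_int_eqD[OF this] have e: "(\<alpha> + \<beta>) * nat (int n - i) + texp \<alpha> \<beta> (i + 1) = \<alpha> + (\<alpha> + \<beta>) * n + texp \<alpha> \<beta> i" .
  have t: "fps_const (tsgn s (i + 1)) = fps_const s * fps_const (tsgn s i)"
    using s by (simp add: tsgn_def)
  have "fps_X ^ ((\<alpha> + \<beta>) * nat (int n - i)) * tterm s \<alpha> \<beta> (i + 1)
      = fps_const (tsgn s (i + 1)) * fps_X ^ ((\<alpha> + \<beta>) * nat (int n - i) + texp \<alpha> \<beta> (i + 1))"
    by (simp only: power_add mult_ac)
  thus ?thesis unfolding e t by (simp only: power_add mult_ac)
qed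

lemma tterm_pred:
  assumes s: "s * s = 1" and i: "- int n \<le> i"
  shows "fps_X ^ ((\<alpha> + \<beta>) * nat (int n + i)) * tterm s \<alpha> \<beta> (i - 1)
    = fps_const s * fps_X ^ (\<beta> + (\<alpha> + \<beta>) * n) * tterm s \<alpha> \<beta> i"
proof -
  have "2 * int ((\<alpha> + \<beta>) * nat (int n + i) + texp \<alpha> \<beta> (i - 1))
      = 2 * int (\<beta> + (\<alpha> + \<beta>) * n + texp \<alpha> \<beta> i)"
    using i texp[of \<alpha> \<beta> i] texp[of \<alpha> \<beta> "i - 1"] by (simp add: algebra_simps)
  from double_int_eqD[OF this] have e: "(\<alpha> + \<beta>) * nat (int n + i) + texp \<alpha> \<beta> (i - 1) = \<beta> + (\<alpha> + \<beta>) * n + texp \<alpha> \<beta> i" .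
  have t: "fps_const (tsgn s (i - 1)) = fps_const s * fps_const (tsgn s i)"
    using s by (simp add: tsgn_def)
  have "fps_X ^ ((\<alpha> + \<beta>) * nat (int n + i)) * tterm s \<alpha> \<beta> (i - 1)
      = fps_const (tsgn s (i - 1)) * fps_X ^ ((\<alpha> + \<beta>) * nat (int n + i) + texp \<alpha> \<beta> (i - 1))"
    by (simp only: power_add mult_ac)
  thus ?thesis unfolding e t by (simp only: power_add mult_ac)
qed

lemma qbin_0 [simp]: "qbin d 0 0 = 1"
  using inv_fps[of 1] by (simp add: qbin_def rec_euler_def)

lemma texp_0 [simp]: "texp \<alpha> \<beta> 0 = 0"
  by (simp add: texp_def)

lemma tsgn_0 [simp]: "tsgn s 0 = 1"
  by (simp add: tsgn_def)

text \<open>With the shifts evaluated, every term of the sum for \<open>Suc n\<close> acquires the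
  factor \<open>1 + a * b + S * a + S * b\<close>, which is \<open>(1 + S * a) * (1 + S * b)\<close>
  because \<open>S * S = 1\<close>.\<close>

lemma finite_triple_product:
  assumes s: "s * s = 1" and pos: "\<alpha> + \<beta> > 0"
  shows "(\<Sum>i=-int n..int n. tterm s \<alpha> \<beta> i * qbin (\<alpha> + \<beta>) n i) =
    (\<Prod>j<n. (1 + fps_const s * fps_X ^ (\<alpha> + (\<alpha> + \<beta>) * j)) * (1 + fps_const s * fps_X ^ (\<beta> + (\<alpha> + \<beta>) * j)))"
proof (induction n)
  case (Suc n)
  define S a b where "S = fps_const s" and "a = (fps_X :: int fps) ^ (\<alpha> + (\<alpha> + \<beta>) * n)"
    and "b = (fps_X :: int fps) ^ (\<beta> + (\<alpha> + \<beta>) * n)"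
  have SS: "S * S = 1" using s by (simp add: S_def)
  have alg: "((1 + a * b) * T + S * a * T + S * b * T) * B = (1 + S * a) * (1 + S * b) * (T * B)" for T B
    using SS by algebra
  have ab: "(fps_X :: int fps) ^ ((\<alpha> + \<beta>) * (2 * n + 1)) = a * b"
    by (simp add: a_def b_def algebra_simps flip: power_add)
  have "(\<Sum>i=-int (Suc n)..int (Suc n). tterm s \<alpha> \<beta> i * qbin (\<alpha> + \<beta>) (Suc n) i) =
      (\<Sum>i=-int n..int n. (1 + S * a) * (1 + S * b) * (tterm s \<alpha> \<beta> i * qbin (\<alpha> + \<beta>) n i))"
    unfolding qbin_sum_Suc[OF pos]
  proof (intro sum.cong refl)
    fix i assume "i \<in> {-int n..int n}"
    hence i: "i \<le> int n" "- int n \<le> i" by auto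
    show "((1 + fps_X ^ ((\<alpha> + \<beta>) * (2 * n + 1))) * tterm s \<alpha> \<beta> i
        + fps_X ^ ((\<alpha> + \<beta>) * nat (int n - i)) * tterm s \<alpha> \<beta> (i + 1)
        + fps_X ^ ((\<alpha> + \<beta>) * nat (int n + i)) * tterm s \<alpha> \<beta> (i - 1)) * qbin (\<alpha> + \<beta>) n i
      = (1 + S * a) * (1 + S * b) * (tterm s \<alpha> \<beta> i * qbin (\<alpha> + \<beta>) n i)"
      unfolding tterm_succ[OF s i(1)] tterm_pred[OF s i(2)] ab S_def[symmetric]
        a_def[symmetric] b_def[symmetric] by (rule alg)
  qed
  thus ?case
    unfolding sum_distrib_left[symmetric] Suc.IH prod.lessThan_Suc S_def a_def b_def
    by (simp only: mult.commute)
qed simp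

lemma triple_product_approx:
  assumes "s * s = 1" "\<alpha> + \<beta> > 0"
  shows "fps_X ^ (n - 1) dvd
    (\<Prod>j<n. (1 + fps_const s * fps_X ^ (\<alpha> + (\<alpha> + \<beta>) * j)) * (1 + fps_const s * fps_X ^ (\<beta> + (\<alpha> + \<beta>) * j)))
      * fin_euler (\<alpha> + \<beta>) n - theta (tsgn s) (texp \<alpha> \<beta>)"
  using theta_approx[OF assms(2) texp_ge[OF assms(2)], where c = "tsgn s"]
  unfolding finite_triple_product[OF assms] .

lemma fin_euler_shift_approx:
  assumes "d > 0" "n \<le> m"
  shows "fps_X ^ (n - 1) dvd fin_euler d m - euler_f d"
proof -
  have "fps_X ^ m dvd euler_f d - fin_euler d m" by (rule euler_f_approx[OF assms(1)])
  moreover have "(fps_X :: int fps) ^ (n - 1) dvd fps_X ^ m"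
    using assms by (intro le_imp_power_dvd) auto
  ultimately have "fps_X ^ (n - 1) dvd euler_f d - fin_euler d m" by (rule dvd_trans[rotated])
  thus ?thesis by (metis dvd_minus_iff minus_diff_eq)
qed

lemma fps_eq_if_approx:
  fixes f g :: "int fps"
  assumes "\<And>n. fps_X ^ (n - 1) dvd u n - f" "\<And>n. fps_X ^ (n - 1) dvd v n - g" "\<And>n. u n = v n"
  shows "f = g"
proof (rule fps_eq_if_X_power_dvd)
  fix n
  show "fps_X ^ n dvd f - g"
    using dvd_diff[OF assms(2)[of "Suc n"] assms(1)[of "Suc n"]] by (simp add: assms(3))
qed

section \<open>Euler's, Gauss's and Jacobi's specializations of the triple product\<close>

lemma minus_one_term: "1 + fps_const (-1) * f = 1 - (f :: int fps)"
  by (simp flip: fps_const_neg)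

text \<open>Euler's pentagonal number theorem: for \<open>\<alpha> = 1\<close> and
  \<open>\<beta> = 2\<close> the three products run through the exponents congruent to 1, 2 and 0
  modulo 3, hence through all of them.\<close>

lemma pentagonal_theta: "euler_f 1 = theta (tsgn (-1)) (texp 1 2)"
proof (rule fps_eq_if_approx)
  show "fps_X ^ (n - 1) dvd fin_euler 1 (3 * n) - euler_f 1" for n
    by (rule fin_euler_shift_approx) auto
  show "fps_X ^ (n - 1) dvd
     (\<Prod>j<n. (1 + fps_const (-1) * fps_X ^ (1 + (1 + 2) * j)) * (1 + fps_const (-1) * fps_X ^ (2 + (1 + 2) * j)))
      * fin_euler (1 + 2) n - theta (tsgn (-1)) (texp 1 2)" for n
    by (rule triple_product_approx) auto
  show "fin_euler 1 (3 * n) = (\<Prod>j<n. (1 + fps_const (-1) * fps_X ^ (1 + (1 + 2) * j)) *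
      (1 + fps_const (-1) * fps_X ^ (2 + (1 + 2) * j))) * fin_euler (1 + 2) n" for n
    unfolding minus_one_term
  proof (induction n)
    case (Suc n)
    have e: "1 * Suc (3 * n) = 1 + (1 + 2) * n" "1 * Suc (Suc (3 * n)) = 2 + (1 + 2) * n"
      "1 * Suc (Suc (Suc (3 * n))) = (1 + 2) * Suc n" "3 * Suc n = Suc (Suc (Suc (3 * n)))"
      by simp_all
    show ?case
      unfolding e(4) fin_euler_Suc e(1-3) Suc.IH prod.lessThan_Suc by (simp only: mult_ac)
  qed simp
qed

lemma fin_euler_mult_plus:
  "fin_euler 1 n * (\<Prod>j<n. 1 + fps_X ^ Suc j) = fin_euler 2 n"
proof (induction n)
  case (Suc n)
  have *: "F * (1 - x) * (P * (1 + x)) = F * P * (1 - x * x)" for F P x :: "int fps"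
    by algebra
  have e: "1 * Suc n = Suc n" "2 * Suc n = Suc n + Suc n" by simp_all
  show ?case
    unfolding fin_euler_Suc prod.lessThan_Suc e power_add Suc.IH[symmetric] by (rule *)
qed simp

text \<open>Gauss's series for the triangular numbers. The 2 comes from the factor
  \<open>1 + fps_X ^ 0\<close> of the product; in the series it reflects the symmetry between
  \<open>i\<close> and \<open>1 - i\<close>.\<close>

lemma theta_tri: "theta (tsgn 1) (texp 0 1) * euler_f 1 = 2 * euler_f 2 ^ 2"
proof (rule fps_eq_if_approx)
  let ?P = "\<lambda>n. (\<Prod>j<n. (1 + fps_const 1 * fps_X ^ (0 + (0 + 1) * j)) * (1 + fps_const 1 * fps_X ^ (1 + (0 + 1) * j)))
      * fin_euler (0 + 1) n"
  have P: "fps_X ^ (n - 1) dvd ?P n - theta (tsgn 1) (texp 0 1)" for n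
    by (rule triple_product_approx) auto
  \<comment> \<open>This extra factor turns the product of \<open>1 + fps_X ^ j\<close> into twice
    that of \<open>1 + fps_X ^ Suc j\<close>, at no cost modulo
    \<open>fps_X ^ (n - 1)\<close>.\<close>
  have X: "fps_X ^ (n - 1) dvd (1 + fps_X ^ n) - (1 :: int fps)" for n
    by (simp add: le_imp_power_dvd)
  show "fps_X ^ (n - 1) dvd ?P n * fin_euler 1 n * (1 + fps_X ^ n) - theta (tsgn 1) (texp 0 1) * euler_f 1" for n
    using dvd_diff_mult[OF dvd_diff_mult[OF P fin_euler_shift_approx[of 1 n n]] X[of n]] by simp
  show "fps_X ^ (n - 1) dvd 2 * fin_euler 2 n ^ 2 - 2 * euler_f 2 ^ 2" for n
    unfolding power2_eq_square right_diff_distrib[symmetric]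
    by (intro dvd_mult dvd_diff_mult fin_euler_shift_approx) auto
  have *: "P * F * x = 2 * E ^ 2" if "p * x = 2 * R" "P = p * R * F" "E = F * R" for P F x E p R :: "int fps"
    using that by algebra
  show "?P n * fin_euler 1 n * (1 + fps_X ^ n) = 2 * fin_euler 2 n ^ 2" for n
  proof -
    define R where "R = (\<Prod>j<n. 1 + fps_X ^ Suc j :: int fps)"
    have "(\<Prod>j<n. 1 + fps_X ^ j) * (1 + fps_X ^ n) = 2 * R"
      unfolding R_def using prod.lessThan_Suc_shift[of "\<lambda>j. 1 + fps_X ^ j :: int fps" n]
      by (simp add: prod.lessThan_Suc)
    moreover have "?P n = (\<Prod>j<n. 1 + fps_X ^ j) * R * fin_euler 1 n"
      by (simp add: R_def prod.distrib)
    moreover have "fin_euler 2 n = fin_euler 1 n * R"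
      using fin_euler_mult_plus[of n] by (simp add: R_def)
    ultimately show ?thesis by (rule *)
  qed
qed

text \<open>Gauss's series for the squares: \<open>fin_euler 1 (2 * n)\<close> splits into
  \<open>fin_euler 2 n\<close> and its odd exponents, which the triple product contains
  twice.\<close>

lemma theta_sq: "theta (tsgn (-1)) (texp 1 1) * euler_f 2 = euler_f 1 ^ 2"
proof (rule fps_eq_if_approx)
  let ?P = "\<lambda>n. (\<Prod>j<n. (1 + fps_const (-1) * fps_X ^ (1 + (1 + 1) * j)) * (1 + fps_const (-1) * fps_X ^ (1 + (1 + 1) * j)))
      * fin_euler (1 + 1) n"
  have P: "fps_X ^ (n - 1) dvd ?P n - theta (tsgn (-1)) (texp 1 1)" for n
    by (rule triple_product_approx) auto
  show "fps_X ^ (n - 1) dvd ?P n * fin_euler 2 n - theta (tsgn (-1)) (texp 1 1) * euler_f 2" for n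
    by (intro dvd_diff_mult P fin_euler_shift_approx) auto
  show "fps_X ^ (n - 1) dvd fin_euler 1 (2 * n) ^ 2 - euler_f 1 ^ 2" for n
    unfolding power2_eq_square by (intro dvd_diff_mult fin_euler_shift_approx) auto
  show "?P n * fin_euler 2 n = fin_euler 1 (2 * n) ^ 2" for n
  proof -
    define R where "R = (\<Prod>j<n. 1 - fps_X ^ (1 + 2 * j) :: int fps)"
    have R: "fin_euler 1 (2 * n) = R * fin_euler 2 n" unfolding R_def
    proof (induction n)
      case (Suc n)
      have "2 * Suc n = Suc (Suc (2 * n))" by simp
      thus ?case using Suc by (simp add: fin_euler_Suc eval_nat_numeral algebra_simps)
    qed simp
    have "?P n = R * R * fin_euler 2 n"
      unfolding minus_one_term by (simp add: R_def prod.distrib numeral_2_eq_2)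
    thus ?thesis unfolding R by (simp add: power2_eq_square mult_ac)
  qed
qed

text \<open>Jacobi's identity; a finite recurrence replaces the derivative of the triple product at
  a zero. The weight \<open>i\<close> adds to the recurrence for \<open>S\<close> a multiple of the
  unweighted sum \<open>Z\<close>. Since \<open>Z\<close> contains \<open>1 - fps_X ^ 0\<close>, it
  vanishes at positive indices, and only the step from 0 to 1 starts the product.\<close>

lemma theta_cube: "theta (\<lambda>i. i * tsgn (-1) i) (texp 0 1) = - (euler_f 1 ^ 3)"
proof (rule fps_eq_if_approx)
  define S where "S n = (\<Sum>i=-int n..int n. fps_const (i * tsgn (-1) i) * fps_X ^ texp 0 1 i * qbin 1 n i)" for n
  define Z where "Z n = (\<Sum>i=-int n..int n. tterm (-1) 0 1 i * qbin 1 n i)" for n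
  have Z: "Z n = (\<Prod>j<n. (1 - fps_X ^ j) * (1 - fps_X ^ Suc j))" for n
    using finite_triple_product[of "-1" 0 1 n] by (simp add: Z_def flip: fps_const_neg)
  have Z0: "Z (Suc n) = 0" for n
    unfolding Z by (rule prod_zero) (auto intro!: bexI[of _ 0])
  have S: "S (Suc n) = (1 - fps_X ^ n) * (1 - fps_X ^ Suc n) * S n - (fps_X ^ n - fps_X ^ Suc n) * Z n" for n
  proof -
    have "S (Suc n) = (\<Sum>i=-int n..int n. (1 - fps_X ^ n) * (1 - fps_X ^ Suc n) *
         (fps_const (i * tsgn (-1) i) * fps_X ^ texp 0 1 i * qbin 1 n i)
        - (fps_X ^ n - fps_X ^ Suc n) * (tterm (-1) 0 1 i * qbin 1 n i))"
      unfolding S_def qbin_sum_Suc[OF zero_less_one]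
    proof (intro sum.cong refl)
      fix i assume "i \<in> {-int n..int n}"
      hence i: "i \<le> int n" "- int n \<le> i" by auto
      have c: "fps_const (k * m) * f = fps_const k * (fps_const m * f)" for k m and f :: "int fps"
        by (simp add: mult.assoc)
      have 1: "fps_X ^ (1 * nat (int n - i)) * tterm (-1) 0 1 (i + 1) = - (fps_X ^ n) * tterm (-1) 0 1 i"
        using tterm_succ[of "-1" i n 0 1] i by (simp flip: fps_const_neg)
      have 2: "fps_X ^ (1 * nat (int n + i)) * tterm (-1) 0 1 (i - 1) = - fps_X * fps_X ^ n * tterm (-1) 0 1 i"
        using tterm_pred[of "-1" n i 0 1] i by (simp flip: fps_const_neg)
      have 3: "(fps_X :: int fps) ^ (1 * (2 * n + 1)) = fps_X * fps_X ^ n * fps_X ^ n"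
      proof -
        have "1 * (2 * n + 1) = 1 + n + n" by simp
        thus ?thesis by (simp only: power_add power_one_right)
      qed
      have 4: "fps_const (i + 1) = fps_const i + 1" "fps_const (i - 1) = fps_const i - 1"
        by (simp_all flip: fps_const_add fps_const_sub)
      have alg: "((1 + q * a * a) * (I * t) + X * ((I + 1) * u) + Y * ((I - 1) * v)) * B =
        (1 - a) * (1 - q * a) * (I * t * B) - (a - q * a) * (t * B)"
        if "X * u = - a * t" "Y * v = - q * a * t" for q a I t B X Y u v :: "int fps"
        using that by algebra
      show "((1 + fps_X ^ (1 * (2 * n + 1))) * (fps_const (i * tsgn (-1) i) * fps_X ^ texp 0 1 i)
        + fps_X ^ (1 * nat (int n - i)) * (fps_const ((i + 1) * tsgn (-1) (i + 1)) * fps_X ^ texp 0 1 (i + 1))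
        + fps_X ^ (1 * nat (int n + i)) * (fps_const ((i - 1) * tsgn (-1) (i - 1)) * fps_X ^ texp 0 1 (i - 1)))
          * qbin 1 n i
        = (1 - fps_X ^ n) * (1 - fps_X ^ Suc n) * (fps_const (i * tsgn (-1) i) * fps_X ^ texp 0 1 i * qbin 1 n i)
        - (fps_X ^ n - fps_X ^ Suc n) * (tterm (-1) 0 1 i * qbin 1 n i)"
        unfolding c 3 4 power_Suc by (rule alg[OF 1 2])
    qed
    thus ?thesis by (simp add: S_def Z_def sum_subtractf sum_distrib_left)
  qed
  have S1: "S (Suc n) = - (fin_euler 1 n * fin_euler 1 (Suc n))" for n
  proof (induction n)
    case 0
    have "Z 0 = 1" by (simp add: Z)
    moreover have "S 0 = 0" by (simp add: S_def)
    ultimately show ?case using S[of 0] by (simp add: fin_euler_Suc)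
  next
    case (Suc n)
    show ?case unfolding S[of "Suc n"] Z0 Suc by (simp add: fin_euler_Suc mult_ac)
  qed
  show "fps_X ^ (n - 1) dvd S n * fin_euler 1 n - theta (\<lambda>i. i * tsgn (-1) i) (texp 0 1)" for n
    unfolding S_def by (rule theta_approx) (use texp_ge[of 0 1] in auto)
  show "fps_X ^ (n - 1) dvd S n * fin_euler 1 n - - (euler_f 1 ^ 3)" for n
  proof (cases n)
    case (Suc m)
    have "fps_X ^ m dvd fin_euler 1 k - euler_f 1" if "k \<ge> m" for k
      using euler_f_approx[of 1 k] that
      by (metis dvd_minus_iff minus_diff_eq dvd_trans le_imp_power_dvd zero_less_one)
    hence "fps_X ^ m dvd fin_euler 1 m * fin_euler 1 (Suc m) * fin_euler 1 (Suc m)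
        - euler_f 1 * euler_f 1 * euler_f 1"
      by (intro dvd_diff_mult) auto
    hence "fps_X ^ m dvd - (fin_euler 1 m * fin_euler 1 (Suc m) * fin_euler 1 (Suc m)
        - euler_f 1 * euler_f 1 * euler_f 1)"
      by (simp only: dvd_minus_iff)
    thus ?thesis by (simp add: Suc S1 power3_eq_cube)
  qed simp
qed (rule refl)

section \<open>Five-dissections\<close>

definition sect :: "nat \<Rightarrow> int fps \<Rightarrow> int fps" where
  "sect r f = Abs_fps (\<lambda>n. fps_nth f (5 * n + r))"

definition dil :: "nat \<Rightarrow> int fps \<Rightarrow> int fps" where
  "dil k f = Abs_fps (\<lambda>n. if k dvd n then fps_nth f (n div k) else 0)"

lemma sect_nth: "fps_nth (sect r f) n = fps_nth f (5 * n + r)"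
  by (simp add: sect_def)

lemma sect_add [simp]: "sect r (f + g) = sect r f + sect r g"
  and sect_diff [simp]: "sect r (f - g) = sect r f - sect r g"
  and sect_uminus [simp]: "sect r (- f) = - sect r f"
  by (simp_all add: fps_eq_iff sect_nth)

lemma sect_fps_const_mult [simp]: "sect r (fps_const c * f) = fps_const c * sect r f"
  by (simp add: fps_eq_iff sect_nth)

lemma sect_numeral_mult [simp]: "sect r (numeral c * f) = numeral c * sect r f"
  unfolding fps_numeral_fps_const by simp

lemma sect_X_mult_0 [simp]: "sect 0 (fps_X * f) = fps_X * sect 4 f"
proof (rule fps_ext)
  fix n show "fps_nth (sect 0 (fps_X * f)) n = fps_nth (fps_X * sect 4 f) n"
    by (cases n) (simp_all add: sect_nth add.commute)
qed

lemma sect_X_mult_Suc: "sect (Suc r) (fps_X * f) = sect r f"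
  by (simp add: fps_eq_iff sect_nth)

lemma sect_X_mult [simp]:
  "sect 1 (fps_X * f) = sect 0 f" "sect (Suc 0) (fps_X * f) = sect 0 f"
  "sect 2 (fps_X * f) = sect 1 f"
  "sect 3 (fps_X * f) = sect 2 f" "sect 4 (fps_X * f) = sect 3 f"
  using sect_X_mult_Suc[of 0] sect_X_mult_Suc[of 1] sect_X_mult_Suc[of 2] sect_X_mult_Suc[of 3]
  by (simp_all add: numeral_eq_Suc)

lemma dil_nth: "fps_nth (dil k f) n = (if k dvd n then fps_nth f (n div k) else 0)"
  by (simp add: dil_def)

lemma dil_add [simp]: "dil k (f + g) = dil k f + dil k g"
  and dil_diff [simp]: "dil k (f - g) = dil k f - dil k g"
  and dil_uminus [simp]: "dil k (- f) = - dil k f"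
  and dil_0 [simp]: "dil k 0 = 0"
  by (simp_all add: fps_eq_iff dil_nth)

lemma dil_fps_const_mult [simp]: "dil k (fps_const c * f) = fps_const c * dil k f"
  by (simp add: fps_eq_iff dil_nth)

lemma dil_1 [simp]: "k > 0 \<Longrightarrow> dil k 1 = 1"
  by (auto simp: fps_eq_iff dil_nth elim!: dvdE)

lemma dil_X_power: "k > 0 \<Longrightarrow> dil k (fps_X ^ n) = fps_X ^ (k * n)"
  by (auto simp: fps_eq_iff dil_nth fps_X_power_nth elim!: dvdE)

lemma dil_mult_nth:
  assumes "k > 0"
  shows "fps_nth (dil k u * f) n = (\<Sum>j\<le>n div k. fps_nth u j * fps_nth f (n - k * j))"
proof -
  have "fps_nth (dil k u * f) n = (\<Sum>i=0..n. fps_nth (dil k u) i * fps_nth f (n - i))"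
    by (rule fps_mult_nth)
  also have "\<dots> = (\<Sum>i\<in>(*) k ` {..n div k}. fps_nth (dil k u) i * fps_nth f (n - i))"
  proof (rule sum.mono_neutral_right)
    show "(*) k ` {..n div k} \<subseteq> {0..n}"
      using assms by (auto simp: less_eq_div_iff_mult_less_eq mult.commute)
    show "\<forall>i\<in>{0..n} - (*) k ` {..n div k}. fps_nth (dil k u) i * fps_nth f (n - i) = 0"
    proof safe
      fix i assume i: "i \<in> {0..n}" "i \<notin> (*) k ` {..n div k}"
      have "\<not> k dvd i"
      proof
        assume "k dvd i"
        then obtain j where "i = k * j" ..
        thus False using i assms by (auto simp: less_eq_div_iff_mult_less_eq mult.commute)
      qed
      thus "fps_nth (dil k u) i * fps_nth f (n - i) = 0" by (simp add: dil_nth)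
    qed
  qed simp
  also have "\<dots> = (\<Sum>j\<le>n div k. fps_nth u j * fps_nth f (n - k * j))"
    using assms by (subst sum.reindex) (auto simp: inj_on_def dil_nth)
  finally show ?thesis .
qed

lemma dil_mult [simp]:
  assumes k: "k > 0"
  shows "dil k (f * g) = dil k f * dil k g"
proof (rule fps_ext)
  fix n
  show "fps_nth (dil k (f * g)) n = fps_nth (dil k f * dil k g) n"
  proof (cases "k dvd n")
    case True
    then obtain m where n: "n = k * m" ..
    have "fps_nth (dil k f * dil k g) n = (\<Sum>j\<le>m. fps_nth f j * fps_nth g (m - j))"
      unfolding dil_mult_nth[OF k] n using k
      by (intro sum.cong) (auto simp: dil_nth diff_mult_distrib2[symmetric])
    thus ?thesis using k by (simp add: n dil_nth fps_mult_nth atLeast0AtMost)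
  next
    case False
    have "\<not> k dvd n - k * j" if "j \<le> n div k" for j
    proof
      assume d: "k dvd n - k * j"
      have "k * j \<le> n" using that k by (simp add: less_eq_div_iff_mult_less_eq mult.commute)
      with d have "k dvd n" by (metis dvd_diffD dvd_triv_left)
      thus False using False by simp
    qed
    thus ?thesis using False unfolding dil_mult_nth[OF k] by (simp add: dil_nth)
  qed
qed

lemma dil_power [simp]: "k > 0 \<Longrightarrow> dil k (f ^ n) = dil k f ^ n"
  by (induction n) simp_all

lemma dil_nth_0 [simp]: "fps_nth (dil k f) 0 = fps_nth f 0"
  by (simp add: dil_nth)

lemma dil_cong_X_power:
  assumes "fps_X ^ n dvd f" "k > 0"
  shows "fps_X ^ n dvd dil k f"
  unfolding fps_X_power_dvd_iff
proof safe
  fix i assume i: "i < n"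
  have "i div k < n" using i assms(2) by (meson div_le_dividend le_less_trans)
  thus "fps_nth (dil k f) i = 0"
    using assms(1) unfolding fps_X_power_dvd_iff by (simp add: dil_nth)
qed

lemma dil_fin_euler: "k > 0 \<Longrightarrow> dil k (fin_euler m n) = fin_euler (k * m) n"
proof (induction n)
  case (Suc n)
  have "dil k (1 - fps_X ^ (m * Suc n)) = 1 - fps_X ^ (k * m * Suc n)"
    using Suc.prems unfolding dil_diff by (simp only: dil_X_power dil_1 mult.assoc)
  thus ?case using Suc unfolding fin_euler_Suc by simp
qed simp

lemma euler_f_dil:
  assumes "k > 0" "m > 0"
  shows "euler_f (k * m) = dil k (euler_f m)"
proof (rule fps_eq_if_approx[of "fin_euler (k * m)" _ "\<lambda>n. dil k (fin_euler m n)"])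
  show "fps_X ^ (n - 1) dvd fin_euler (k * m) n - euler_f (k * m)" for n
    using assms by (intro fin_euler_shift_approx) auto
  show "fps_X ^ (n - 1) dvd dil k (fin_euler m n) - dil k (euler_f m)" for n
    unfolding dil_diff[symmetric] using assms by (intro dil_cong_X_power fin_euler_shift_approx) auto
qed (use assms in \<open>simp add: dil_fin_euler\<close>)

lemma sect_dil_mult [simp]:
  assumes "r < 5"
  shows "sect r (dil 5 u * f) = u * sect r f"
proof (rule fps_ext)
  fix n
  have "(5 * n + r) div 5 = n" using assms by simp
  hence "fps_nth (sect r (dil 5 u * f)) n = (\<Sum>j\<le>n. fps_nth u j * fps_nth f (5 * n + r - 5 * j))"
    unfolding sect_nth by (simp add: dil_mult_nth)
  also have "\<dots> = (\<Sum>j\<le>n. fps_nth u j * fps_nth (sect r f) (n - j))"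
    by (intro sum.cong refl) (simp add: sect_nth diff_mult_distrib2)
  finally show "fps_nth (sect r (dil 5 u * f)) n = fps_nth (u * sect r f) n"
    by (simp add: fps_mult_nth atLeast0AtMost)
qed

lemma sect_mult_dil [simp]: "r < 5 \<Longrightarrow> sect r (f * dil 5 u) = sect r f * u"
  using sect_dil_mult[of r u f] by (simp add: mult.commute)

lemma sect_one [simp]: "sect 0 1 = 1" "0 < r \<Longrightarrow> r < 5 \<Longrightarrow> sect r 1 = 0"
  by (auto simp: fps_eq_iff sect_nth)

lemma sect_dil [simp]: "sect 0 (dil 5 u) = u" "0 < r \<Longrightarrow> r < 5 \<Longrightarrow> sect r (dil 5 u) = 0"
  using sect_dil_mult[of 0 u 1] sect_dil_mult[of r u 1] by simp_all

text \<open>In Horner form every component can be computed by the rules for \<open>fps_X\<close> and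
  \<open>dil 5\<close>; the cofactors below are built in the same form for that reason.\<close>

lemma dissection:
  "f = dil 5 (sect 0 f) + fps_X * (dil 5 (sect 1 f) + fps_X * (dil 5 (sect 2 f) +
     fps_X * (dil 5 (sect 3 f) + fps_X * dil 5 (sect 4 f))))" (is "_ = ?g")
proof (rule fps_ext)
  fix n :: nat
  define r where "r = n mod 5"
  have n: "n = 5 * (n div 5) + r" by (simp add: r_def)
  have "r < 5" by (simp add: r_def)
  hence "r = 0 \<or> r = 1 \<or> r = 2 \<or> r = 3 \<or> r = 4" by linarith
  hence "sect r f = sect r ?g" by (elim disjE) simp_all
  hence "fps_nth (sect r f) (n div 5) = fps_nth (sect r ?g) (n div 5)" by simp
  thus "fps_nth f n = fps_nth ?g n" unfolding sect_nth n[symmetric] .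
qed

lemma sect_mult:
  "sect 0 (f * g) = sect 0 f * sect 0 g + fps_X * (sect 1 f * sect 4 g + sect 2 f * sect 3 g
     + sect 3 f * sect 2 g + sect 4 f * sect 1 g)"
  "sect 1 (f * g) = sect 0 f * sect 1 g + sect 1 f * sect 0 g
     + fps_X * (sect 2 f * sect 4 g + sect 3 f * sect 3 g + sect 4 f * sect 2 g)"
  "sect 2 (f * g) = sect 0 f * sect 2 g + sect 1 f * sect 1 g + sect 2 f * sect 0 g
     + fps_X * (sect 3 f * sect 4 g + sect 4 f * sect 3 g)"
  "sect 3 (f * g) = sect 0 f * sect 3 g + sect 1 f * sect 2 g + sect 2 f * sect 1 g
     + sect 3 f * sect 0 g + fps_X * (sect 4 f * sect 4 g)"
  "sect 4 (f * g) = sect 0 f * sect 4 g + sect 1 f * sect 3 g + sect 2 f * sect 2 g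
     + sect 3 f * sect 1 g + sect 4 f * sect 0 g"
proof -
  have fg: "f * g = dil 5 (sect 0 f) * g + fps_X * (dil 5 (sect 1 f) * g + fps_X * (dil 5 (sect 2 f) * g +
     fps_X * (dil 5 (sect 3 f) * g + fps_X * (dil 5 (sect 4 f) * g))))"
    by (subst dissection[of f]) (simp add: algebra_simps)
  show "sect 0 (f * g) = sect 0 f * sect 0 g + fps_X * (sect 1 f * sect 4 g + sect 2 f * sect 3 g
     + sect 3 f * sect 2 g + sect 4 f * sect 1 g)"
  "sect 1 (f * g) = sect 0 f * sect 1 g + sect 1 f * sect 0 g
     + fps_X * (sect 2 f * sect 4 g + sect 3 f * sect 3 g + sect 4 f * sect 2 g)"
  "sect 2 (f * g) = sect 0 f * sect 2 g + sect 1 f * sect 1 g + sect 2 f * sect 0 g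
     + fps_X * (sect 3 f * sect 4 g + sect 4 f * sect 3 g)"
  "sect 3 (f * g) = sect 0 f * sect 3 g + sect 1 f * sect 2 g + sect 2 f * sect 1 g
     + sect 3 f * sect 0 g + fps_X * (sect 4 f * sect 4 g)"
  "sect 4 (f * g) = sect 0 f * sect 4 g + sect 1 f * sect 3 g + sect 2 f * sect 2 g
     + sect 3 f * sect 1 g + sect 4 f * sect 0 g"
    by (subst fg, simp add: algebra_simps)+
qed

section \<open>Sums of two squares and the prime 5\<close>

definition circ :: "int \<Rightarrow> (int \<times> int) set" where
  "circ m = {(x, y). x^2 + y^2 = m}"

lemma abs_le_square: "\<bar>x :: int\<bar> \<le> x^2"
proof (cases "x = 0")
  case False
  hence "\<bar>x\<bar> * 1 \<le> \<bar>x\<bar> * \<bar>x\<bar>" by (intro mult_left_mono) auto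
  thus ?thesis by (simp only: mult_1_right abs_mult_self_eq power2_eq_square)
qed simp

lemma finite_square_eq: "finite {x :: int. x^2 = m}"
proof (rule finite_subset)
  show "{x. x^2 = m} \<subseteq> {-\<bar>m\<bar>..\<bar>m\<bar>}"
  proof safe
    fix x :: int
    show "x \<in> {-\<bar>x^2\<bar>..\<bar>x^2\<bar>}" using abs_le_square[of x] by (auto simp: abs_le_iff minus_le_iff)
  qed
qed simp

lemma finite_circ: "finite (circ m)"
proof (rule finite_subset)
  show "circ m \<subseteq> {-\<bar>m\<bar>..\<bar>m\<bar>} \<times> {-\<bar>m\<bar>..\<bar>m\<bar>}"
  proof safe
    fix x y assume "(x, y) \<in> circ m"
    hence "x^2 + y^2 = m" by (simp add: circ_def)
    moreover have "x^2 \<ge> 0" "y^2 \<ge> 0" by simp_all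
    ultimately have "\<bar>x\<bar> \<le> \<bar>m\<bar>" "\<bar>y\<bar> \<le> \<bar>m\<bar>"
      using abs_le_square[of x] abs_le_square[of y] by linarith+
    thus "x \<in> {-\<bar>m\<bar>..\<bar>m\<bar>}" "y \<in> {-\<bar>m\<bar>..\<bar>m\<bar>}" by auto
  qed
qed simp

text \<open>The two maps \<open>circ m \<rightarrow> circ (5 * m)\<close> are multiplication of \<open>x + i y\<close> by \<open>2 + i\<close> and by \<open>2 - i\<close>.\<close>

lemma circ_5_sum:
  fixes w :: "int \<times> int \<Rightarrow> int"
  shows "(\<Sum>p\<in>circ (5 * m). w p) =
    (\<Sum>(x, y)\<in>circ m. w (2 * x - y, x + 2 * y)) + (\<Sum>(x, y)\<in>circ m. w (2 * x + y, 2 * y - x))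
    - (\<Sum>p\<in>{(x, y)\<in>circ (5 * m). 5 dvd x \<and> 5 dvd y}. w p)"
proof -
  define A where "A = {(x, y)\<in>circ (5 * m). 5 dvd 2 * x + y}"
  define B where "B = {(x, y)\<in>circ (5 * m). 5 dvd 2 * x - y}"
  have "(x, y) \<in> A \<union> B" if "(x, y) \<in> circ (5 * m)" for x y
  proof -
    \<comment> \<open>Modulo 5 the form \<open>x^2 + y^2\<close> is
      \<open>- (2 * x + y) * (2 * x - y)\<close>, so each point is divisible by \<open>2 + i\<close>
      or by \<open>2 - i\<close>.\<close>
    have "(2 * x + y) * (2 * x - y) = 5 * (x^2 - m)"
      using that by (simp add: circ_def power2_eq_square algebra_simps)
    hence "5 dvd (2 * x + y) * (2 * x - y)" by simp
    moreover have "prime (5 :: int)" by simp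
    ultimately have "5 dvd 2 * x + y \<or> 5 dvd 2 * x - y"
      using prime_dvd_mult_iff by blast
    thus ?thesis using that by (auto simp: A_def B_def)
  qed
  hence un: "circ (5 * m) = A \<union> B"
    by (auto simp: A_def B_def)
  have "5 dvd x \<and> 5 dvd y" if "5 dvd 2 * x + y" "5 dvd 2 * x - y" for x y :: int
    using that by presburger
  moreover have "5 dvd 2 * x + y" "5 dvd 2 * x - y" if "5 dvd x \<and> 5 dvd y" for x y :: int
    using that by presburger+
  ultimately have int: "A \<inter> B = {(x, y)\<in>circ (5 * m). 5 dvd x \<and> 5 dvd y}"
    unfolding A_def B_def by blast
  have A: "(\<Sum>p\<in>A. w p) = (\<Sum>(x, y)\<in>circ m. w (2 * x - y, x + 2 * y))"
  proof (rule sum.reindex_bij_witness[where i = "\<lambda>(x, y). (2 * x - y, x + 2 * y)"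
        and j = "\<lambda>(x, y). ((2 * x + y) div 5, (2 * y - x) div 5)"])
    fix p assume "p \<in> A"
    then obtain x y k where p: "p = (x, y)" "x^2 + y^2 = 5 * m" "2 * x + y = 5 * k"
      by (auto simp: A_def circ_def)
    define l where "l = 2 * k - x"
    have xy: "x = 2 * k - l" "y = k + 2 * l" using p(3) by (simp_all add: l_def)
    have d: "(2 * x + y) div 5 = k" "(2 * y - x) div 5 = l" by (simp_all add: xy)
    have "k^2 + l^2 = m" using p(2) unfolding xy by (simp add: power2_eq_square algebra_simps)
    thus "(case case p of (x, y) \<Rightarrow> ((2 * x + y) div 5, (2 * y - x) div 5) of
         (x, y) \<Rightarrow> (2 * x - y, x + 2 * y)) = p"
      "(case p of (x, y) \<Rightarrow> ((2 * x + y) div 5, (2 * y - x) div 5)) \<in> circ m"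
      "(case case p of (x, y) \<Rightarrow> ((2 * x + y) div 5, (2 * y - x) div 5) of
         (x, y) \<Rightarrow> w (2 * x - y, x + 2 * y)) = w p"
      unfolding p prod.case d by (simp_all add: circ_def xy)
  next
    fix p assume "p \<in> circ m"
    thus "(case case p of (x, y) \<Rightarrow> (2 * x - y, x + 2 * y) of
         (x, y) \<Rightarrow> ((2 * x + y) div 5, (2 * y - x) div 5)) = p"
      "(case p of (x, y) \<Rightarrow> (2 * x - y, x + 2 * y)) \<in> A"
      by (auto simp: A_def circ_def power2_eq_square algebra_simps)
  qed
  have B: "(\<Sum>p\<in>B. w p) = (\<Sum>(x, y)\<in>circ m. w (2 * x + y, 2 * y - x))"
  proof (rule sum.reindex_bij_witness[where i = "\<lambda>(x, y). (2 * x + y, 2 * y - x)"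
        and j = "\<lambda>(x, y). ((2 * x - y) div 5, (2 * y + x) div 5)"])
    fix p assume "p \<in> B"
    then obtain x y k where p: "p = (x, y)" "x^2 + y^2 = 5 * m" "2 * x - y = 5 * k"
      by (auto simp: B_def circ_def)
    define l where "l = x - 2 * k"
    have xy: "x = 2 * k + l" "y = 2 * l - k" using p(3) by (simp_all add: l_def)
    have d: "(2 * x - y) div 5 = k" "(2 * y + x) div 5 = l" by (simp_all add: xy)
    have "k^2 + l^2 = m" using p(2) unfolding xy by (simp add: power2_eq_square algebra_simps)
    thus "(case case p of (x, y) \<Rightarrow> ((2 * x - y) div 5, (2 * y + x) div 5) of
         (x, y) \<Rightarrow> (2 * x + y, 2 * y - x)) = p"
      "(case p of (x, y) \<Rightarrow> ((2 * x - y) div 5, (2 * y + x) div 5)) \<in> circ m"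
      "(case case p of (x, y) \<Rightarrow> ((2 * x - y) div 5, (2 * y + x) div 5) of
         (x, y) \<Rightarrow> w (2 * x + y, 2 * y - x)) = w p"
      unfolding p prod.case d by (simp_all add: circ_def xy)
  next
    fix p assume "p \<in> circ m"
    thus "(case case p of (x, y) \<Rightarrow> (2 * x + y, 2 * y - x) of
         (x, y) \<Rightarrow> ((2 * x - y) div 5, (2 * y + x) div 5)) = p"
      "(case p of (x, y) \<Rightarrow> (2 * x + y, 2 * y - x)) \<in> B"
      by (auto simp: B_def circ_def power2_eq_square algebra_simps)
  qed
  have "finite A" "finite B"
    using finite_circ[of "5 * m"] by (simp_all add: un)
  hence "sum w (A \<union> B) + sum w (A \<inter> B) = sum w A + sum w B"
    by (rule sum.union_inter)
  thus ?thesis unfolding un[symmetric] int A B by linarith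
qed

section \<open>Series supported on squares and their products\<close>

definition sq_series :: "nat \<Rightarrow> nat \<Rightarrow> (int \<Rightarrow> int) \<Rightarrow> int fps" where
  "sq_series K L u = Abs_fps (\<lambda>n. \<Sum>x | x^2 = int (K * n + L). u x)"

text \<open>The pair \<open>(8, 1)\<close> stands for the exponents \<open>(x\<^sup>2 - 1) / 8\<close>, \<open>x\<close> odd, and \<open>(1, 0)\<close> for the exponents \<open>x\<^sup>2\<close>.\<close>

definition sq_modulus :: "nat \<Rightarrow> nat \<Rightarrow> bool" where
  "sq_modulus K L \<longleftrightarrow> (K, L) \<in> {(8, 1), (1, 0)}"

lemma odd_square_mod_8:
  fixes x :: int
  assumes "odd x"
  shows "\<exists>i. x^2 = int (8 * i + 1)"
proof -
  from assms obtain k where k: "x = 2 * k + 1" by (elim oddE)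
  have "even (k * (k + 1))" by simp
  then obtain j where j: "k * (k + 1) = 2 * j" by (elim evenE)
  have "k * (k + 1) \<ge> 0" by (auto simp: zero_le_mult_iff)
  hence "j \<ge> 0" using j by simp
  have "x^2 = 4 * (k * (k + 1)) + 1" by (simp add: k power2_eq_square algebra_simps)
  hence "x^2 = int (8 * nat j + 1)" using \<open>j \<ge> 0\<close> by (simp add: j)
  thus ?thesis ..
qed

lemma sq_modulus_split:
  assumes "sq_modulus K L" "x^2 + y^2 = int (K * n + 2 * L)"
  obtains i j where "x^2 = int (K * i + L)" "y^2 = int (K * j + L)" "i + j = n"
proof (cases "K = 8")
  case False
  hence KL: "K = 1" "L = 0" using assms(1) by (auto simp: sq_modulus_def)
  have "x^2 + y^2 = int n" using assms(2) by (simp add: KL)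
  thus ?thesis by (intro that[of "nat (x^2)" "nat (y^2)"])
      (auto simp: KL nat_add_distrib[symmetric])
next
  case True
  hence KL: "K = 8" "L = 1" using assms(1) by (auto simp: sq_modulus_def)
  have e: "x^2 + y^2 = 8 * int n + 2" using assms(2) by (simp add: KL)
  have "odd x \<and> odd y"
  proof (rule ccontr)
    assume "\<not> (odd x \<and> odd y)"
    moreover have "even x \<longleftrightarrow> even y"
    proof -
      have "even (x^2 + y^2)" unfolding e by simp
      thus ?thesis by simp
    qed
    ultimately obtain a b where "x = 2 * a" "y = 2 * b" by (auto elim!: evenE)
    hence "4 * (a^2 + b^2) = 8 * int n + 2" using e by (simp add: power2_eq_square algebra_simps)
    thus False by presburger
  qed
  then obtain i j where "x^2 = int (8 * i + 1)" "y^2 = int (8 * j + 1)"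
    using odd_square_mod_8 by blast
  thus ?thesis using e by (intro that[of i j]) (auto simp: KL)
qed

text \<open>Completing the square turns the Cauchy product into a sum over a circle;
  \<open>sq_modulus_split\<close> ensures that each lattice point there comes from a pair of
  exponents.\<close>

lemma sq_series_mult_nth:
  assumes "sq_modulus K L"
  shows "fps_nth (sq_series K L u * sq_series K L v) n = (\<Sum>(x, y)\<in>circ (int (K * n + 2 * L)). u x * v y)"
proof -
  have K: "K > 0" using assms by (auto simp: sq_modulus_def)
  have "fps_nth (sq_series K L u * sq_series K L v) n =
      (\<Sum>i=0..n. \<Sum>(x, y)\<in>{x. x^2 = int (K * i + L)} \<times> {y. y^2 = int (K * (n - i) + L)}. u x * v y)"
    by (simp add: fps_mult_nth sq_series_def sum_product sum.cartesian_product)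
  also have "\<dots> = (\<Sum>(i, x, y)\<in>(SIGMA i:{0..n}. {x. x^2 = int (K * i + L)} \<times> {y. y^2 = int (K * (n - i) + L)}). u x * v y)"
    by (subst sum.Sigma) (auto simp: finite_square_eq)
  also have "\<dots> = (\<Sum>(x, y)\<in>circ (int (K * n + 2 * L)). u x * v y)"
  proof (rule sum.reindex_bij_witness[where j = "\<lambda>(i, x, y). (x, y)"
      and i = "\<lambda>(x, y). (nat ((x^2 - int L) div int K), x, y)"])
    fix p assume "p \<in> (SIGMA i:{0..n}. {x. x^2 = int (K * i + L)} \<times> {y. y^2 = int (K * (n - i) + L)})"
    then obtain i x y where p: "p = (i, x, y)" "i \<le> n" "x^2 = int (K * i + L)" "y^2 = int (K * (n - i) + L)"
      by auto
    have "(x^2 - int L) div int K = int i" using K by (simp add: p(3))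
    thus "(case case p of (i, x, y) \<Rightarrow> (x, y) of (x, y) \<Rightarrow> (nat ((x^2 - int L) div int K), x, y)) = p"
      by (simp add: p(1))
    have "int K * int n = int K * int i + int K * int (n - i)"
      using p(2) by (simp add: of_nat_diff algebra_simps)
    thus "(case p of (i, x, y) \<Rightarrow> (x, y)) \<in> circ (int (K * n + 2 * L))"
      using p by (simp add: circ_def)
    show "(case case p of (i, x, y) \<Rightarrow> (x, y) of (x, y) \<Rightarrow> u x * v y) = (case p of (i, x, y) \<Rightarrow> u x * v y)"
      by (simp add: p(1))
  next
    fix p assume "p \<in> circ (int (K * n + 2 * L))"
    then obtain x y where p: "p = (x, y)" "x^2 + y^2 = int (K * n + 2 * L)"
      by (auto simp: circ_def)
    obtain i j where ij: "x^2 = int (K * i + L)" "y^2 = int (K * j + L)" "i + j = n"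
      using sq_modulus_split[OF assms p(2)] .
    have i: "(x^2 - int L) div int K = int i" using K by (simp add: ij(1))
    have "j = n - i" "i \<le> n" using ij(3) by auto
    thus "(case p of (x, y) \<Rightarrow> (nat ((x^2 - int L) div int K), x, y))
        \<in> (SIGMA i:{0..n}. {x. x^2 = int (K * i + L)} \<times> {y. y^2 = int (K * (n - i) + L)})"
      using ij by (simp add: p(1) i)
    show "(case case p of (x, y) \<Rightarrow> (nat ((x^2 - int L) div int K), x, y) of (i, x, y) \<Rightarrow> (x, y)) = p"
      by (simp add: p(1))
  qed
  finally show ?thesis .
qed

text \<open>In the class \<open>L\<close> the number \<open>K * (5 * n + L) + 2 * L\<close> is 5
  times \<open>K * n + 2 * L\<close>, so \<open>circ_5_sum\<close> applies.\<close>

lemma sq_series_mult_sect_nth: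
  assumes "sq_modulus K L"
  shows "fps_nth (sect L (sq_series K L u * sq_series K L v)) n =
    (\<Sum>(x, y)\<in>circ (int (K * n + 2 * L)). u (2 * x - y) * v (x + 2 * y) + u (2 * x + y) * v (2 * y - x))
    - (\<Sum>(x, y)\<in>{(x, y)\<in>circ (5 * int (K * n + 2 * L)). 5 dvd x \<and> 5 dvd y}. u x * v y)"
proof -
  have "int (K * (5 * n + L) + 2 * L) = 5 * int (K * n + 2 * L)"
    using assms by (auto simp: sq_modulus_def)
  thus ?thesis
    unfolding sect_nth sq_series_mult_nth[OF assms]
    by (simp only: circ_5_sum prod.case) (simp add: sum.distrib case_prod_unfold)
qed

text \<open>The Hecke operator at 5. By the hypothesis on products, multiplication by
  \<open>2 + i\<close> and by \<open>2 - i\<close> together act as the factor 2; the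
  \<open>dil 5\<close> term removes the points divisible by 5, which both maps reach.\<close>

lemma sq_series_hecke:
  assumes KL: "sq_modulus K L"
    and uv: "\<And>x y n. x^2 + y^2 = int (K * n + 2 * L) \<Longrightarrow>
      u (2 * x - y) * v (x + 2 * y) + u (2 * x + y) * v (2 * y - x) = 2 * (u x * v y)"
    and u5: "\<And>x. u (5 * x) = u x" and v5: "\<And>x. v (5 * x) = v x"
  shows "sect L (sq_series K L u * sq_series K L v) =
    2 * (sq_series K L u * sq_series K L v) - fps_X ^ L * dil 5 (sq_series K L u * sq_series K L v)"
proof (rule fps_ext)
  fix n
  let ?P = "sq_series K L u * sq_series K L v"
  have "(\<Sum>(x, y)\<in>{(x, y)\<in>circ (5 * int (K * n + 2 * L)). 5 dvd x \<and> 5 dvd y}. u x * v y)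
      = fps_nth (fps_X ^ L * dil 5 ?P) n"
  proof (cases "\<exists>m. n = 5 * m + L")
    case True
    then obtain m where m: "n = 5 * m + L" ..
    have e: "int (K * n + 2 * L) = 5 * int (K * m + 2 * L)"
      using KL by (auto simp: sq_modulus_def m)
    define M where "M = int (K * m + 2 * L)"
    have "(\<Sum>(x, y)\<in>{(x, y)\<in>circ (5 * int (K * n + 2 * L)). 5 dvd x \<and> 5 dvd y}. u x * v y)
        = (\<Sum>(x, y)\<in>circ (int (K * m + 2 * L)). u x * v y)"
      unfolding e M_def[symmetric]
      by (rule sum.reindex_bij_witness[where i = "\<lambda>(x, y). (5 * x, 5 * y)"
            and j = "\<lambda>(x, y). (x div 5, y div 5)"])
         (auto simp: circ_def u5 v5 power_mult_distrib elim!: dvdE, (linarith+)?)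
    also have "\<dots> = fps_nth ?P m" by (simp add: sq_series_mult_nth[OF KL])
    also have "\<dots> = fps_nth (fps_X ^ L * dil 5 ?P) n"
      by (simp add: m fps_X_power_mult_nth dil_nth del: dil_mult)
    finally show ?thesis .
  next
    case False
    have "{(x, y)\<in>circ (5 * int (K * n + 2 * L)). 5 dvd x \<and> 5 dvd y} = {}"
    proof safe
      fix x y :: int assume "(x, y) \<in> circ (5 * int (K * n + 2 * L))" "5 dvd x" "5 dvd y"
      then obtain a b where "25 * (a^2 + b^2) = 5 * int (K * n + 2 * L)"
        by (auto simp: circ_def power_mult_distrib elim!: dvdE)
      hence *: "int (K * n + 2 * L) = 5 * (a^2 + b^2)" by simp
      have "5 dvd K * n + 2 * L"
        unfolding int_dvd_int_iff[symmetric] * by simp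
      hence "n mod 5 = L"
        using KL unfolding sq_modulus_def by (auto; presburger)
      hence "n = 5 * (n div 5) + L" by (metis mult_div_mod_eq)
      thus "(x, y) \<in> {}" using False by blast
    qed
    moreover have "fps_nth (fps_X ^ L * dil 5 ?P) n = 0"
    proof (cases "n < L")
      case n: False
      have "\<not> 5 dvd n - L"
      proof
        assume "5 dvd n - L"
        then obtain m where "n - L = 5 * m" ..
        hence "n = 5 * m + L" using n by simp
        thus False using False by blast
      qed
      thus ?thesis by (simp add: fps_X_power_mult_nth dil_nth del: dil_mult)
    qed (simp add: fps_X_power_mult_nth)
    ultimately show ?thesis by (simp only: sum.empty)
  qed
  moreover have "(\<Sum>(x, y)\<in>circ (int (K * n + 2 * L)). u (2 * x - y) * v (x + 2 * y) + u (2 * x + y) * v (2 * y - x))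
      = 2 * fps_nth ?P n"
    unfolding sq_series_mult_nth[OF KL] sum_distrib_left
    by (intro sum.cong refl) (auto simp: circ_def intro!: uv)
  ultimately show "fps_nth (sect L ?P) n = fps_nth (2 * ?P - fps_X ^ L * dil 5 ?P) n"
    by (simp add: sq_series_mult_sect_nth[OF KL] fps_numeral_fps_const del: dil_mult)
qed

section \<open>The algebra of the 5-dissections\<close>

text \<open>
  In terms of the parameter \<open>k = q x y\<^sup>2\<close> all quantities become rational: \<open>d = - 2 x / (1 - k)\<close>,
  \<open>e = 2 y\<^sup>2 / (1 + k)\<close>, \<open>s = (1 + k) x / y\<^sup>2\<close> and \<open>t = (1 - k) / x\<^sup>2\<close>, subject to
  \<open>y (1 - k) = x\<^sup>2 (1 + k)\<close>.
\<close>

lemma quintic_parametrization: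
  fixes x y q d e s t :: "'a :: field"
  assumes nz: "(2 :: 'a) \<noteq> 0" "x \<noteq> 0" "y \<noteq> 0"
    and d1: "d / y - q * e = - 2 / x" and d2: "- d - q * e * y = 2 * x" and d3: "e / y - y = x ^ 2"
    and s: "s / x - q * x = 1 / y ^ 2" and t: "1 / x - t * x = q * y ^ 2"
  shows "5 * (1 + 2 * q * d * e) + 2 * d * (3 / x + q * x ^ 4) + d ^ 2 * (2 / x ^ 2 - q * x ^ 3)
      + q * e ^ 2 * (1 / x ^ 3 + 2 * q * x ^ 2) + 2 * e * (1 / x ^ 4 - 3 * q * x) = 5 * (1 + q * d * e) ^ 2"
    and "1 / x ^ 5 - 11 * q - q ^ 2 * x ^ 5 = (1 + q * d * e) ^ 2 * (s * t + q)"
    and "s ^ 5 + q * t ^ 5 + q ^ 3 + 5 * q * s ^ 2 * t ^ 2 - 5 * q ^ 2 * s * t = (s * t + q) ^ 3"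
proof -
  \<comment> \<open>The claims reduce to powers of \<open>r\<close> times rational functions of
    \<open>k\<close>, with \<open>q = k * r\<close>.\<close>
  define k r where "k = q * x * y ^ 2" and "r = 1 / (x * y ^ 2)"
  have q: "q = k * r" using nz by (simp add: k_def r_def)
  have rx: "r * (x * y ^ 2) = 1" using nz by (simp add: r_def)
  have e0: "e = y * (y + x ^ 2)" using d3 nz by (simp add: field_simps power2_eq_square)
  have d0: "d = - 2 * x - q * e * y" using d2 by algebra
  have "d * x - q * e * x * y = - 2 * y" using d1 nz by (simp add: field_simps)
  \<comment> \<open>Elimination of \<open>d\<close> and \<open>e\<close> from the three equations
    leaves this single relation between \<open>x\<close> and \<open>y\<close>.\<close>
  hence "2 * (y * (1 - k)) = 2 * (x ^ 2 * (1 + k))"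
    unfolding d0 e0 k_def by algebra
  hence rel: "y * (1 - k) = x ^ 2 * (1 + k)"
    using nz(1) by simp
  have k1: "1 - k \<noteq> 0"
  proof
    assume "1 - k = 0"
    hence "x ^ 2 * (1 + k) = 0" "k = 1" using rel by auto
    thus False using nz by simp
  qed
  have k2: "1 + k \<noteq> 0"
  proof
    assume *: "1 + k = 0"
    hence "y * (1 - k) = 0" using rel by simp
    thus False using nz k1 by simp
  qed
  have y: "y = x ^ 2 * (1 + k) / (1 - k)" using rel k1 by (simp add: field_simps)
  have x2: "x ^ 2 = y * (1 - k) / (1 + k)" using rel k2 by (simp add: field_simps)
  have ek: "e * (1 + k) = 2 * y ^ 2" unfolding e0 using rel by algebra
  hence e1: "e = 2 * y ^ 2 / (1 + k)" using k2 by (simp add: field_simps)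
  have d1': "d = - 2 * x / (1 - k)"
  proof -
    have "d * (1 + k) = - 2 * x * (1 + k) - q * y * (2 * y ^ 2)"
      unfolding d0 ek[symmetric] by algebra
    hence "x * (1 - k) * (d * (1 + k)) = - 2 * x ^ 2 * (1 + k) * (1 - k) - 2 * (q * x * y ^ 2) * (y * (1 - k))"
      by algebra
    also have "\<dots> = - 2 * x ^ 2 * (1 + k)"
      unfolding k_def[symmetric] rel by algebra
    finally have "x * (1 + k) * (d * (1 - k)) = x * (1 + k) * (- 2 * x)"
      by algebra
    moreover have "x * (1 + k) \<noteq> 0" using nz k2 by simp
    ultimately have "d * (1 - k) = - 2 * x"
      using mult_left_cancel[of "x * (1 + k)" "d * (1 - k)" "- 2 * x"] by blast
    thus ?thesis using k1 by (simp add: field_simps)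
  qed
  \<comment> \<open>Since \<open>x * y ^ 2\<close> is \<open>1 / r\<close> and \<open>y\<close> is
    \<open>x ^ 2\<close> times a function of \<open>k\<close>, the power \<open>x ^ 5\<close>
    depends on \<open>r\<close> and \<open>k\<close> alone.\<close>
  have x5: "r * x ^ 5 = (1 - k) ^ 2 / (1 + k) ^ 2"
  proof -
    have "(1 + k) ^ 2 * (r * x ^ 5) = r * x * (x ^ 2 * (1 + k)) ^ 2" by algebra
    also have "\<dots> = (1 - k) ^ 2" unfolding rel[symmetric] using rx by algebra
    finally show ?thesis using k2 by (simp add: field_simps)
  qed
  have ix5: "1 / x ^ 5 = r * (1 + k) ^ 2 / (1 - k) ^ 2"
    using x5 nz k1 k2 by (simp add: field_simps)
  have dx: "d / x = - 2 / (1 - k)" unfolding d1' using nz by simp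
  have qde: "q * d * e = - 4 * k / ((1 - k) * (1 + k))"
    unfolding d1' e1 k_def by (simp add: field_simps)
  have dx4: "q * d * x ^ 4 = - 2 * k * (1 - k) / (1 + k) ^ 2"
  proof -
    have "q * d * x ^ 4 = - 2 * k * (r * x ^ 5) / (1 - k)"
      unfolding d1' q by (simp add: field_simps eval_nat_numeral)
    thus ?thesis unfolding x5 using k1 by (simp add: power2_eq_square)
  qed
  have d2x3: "q * d ^ 2 * x ^ 3 = 4 * k / (1 + k) ^ 2"
  proof -
    have "q * d ^ 2 * x ^ 3 = 4 * k * (r * x ^ 5) / (1 - k) ^ 2"
      unfolding d1' q by (simp add: field_simps eval_nat_numeral)
    thus ?thesis unfolding x5 using k1 by simp
  qed
  have y2x4: "y ^ 2 / x ^ 4 = (1 + k) ^ 2 / (1 - k) ^ 2"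
    unfolding y using nz by (simp add: power_mult_distrib power_divide flip: power_mult)
  have e2x3: "q * e ^ 2 / x ^ 3 = 4 * k / (1 - k) ^ 2"
  proof -
    have "q * e ^ 2 / x ^ 3 = 4 * k * (y ^ 2 / x ^ 4) / (1 + k) ^ 2"
      unfolding e1 k_def using nz k2 by (simp add: field_simps eval_nat_numeral)
    thus ?thesis unfolding y2x4 using k2 by simp
  qed
  have ex4: "e / x ^ 4 = 2 * (1 + k) / (1 - k) ^ 2"
  proof -
    have "e / x ^ 4 = 2 * (y ^ 2 / x ^ 4) / (1 + k)"
      unfolding e1 by (simp add: field_simps)
    thus ?thesis unfolding y2x4 using k2 by (simp add: power2_eq_square)
  qed
  have qex: "q * e * x = 2 * k / (1 + k)"
    unfolding e1 k_def by (simp add: field_simps)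
  have "5 * (1 + 2 * q * d * e) + 2 * d * (3 / x + q * x ^ 4) + d ^ 2 * (2 / x ^ 2 - q * x ^ 3)
      + q * e ^ 2 * (1 / x ^ 3 + 2 * q * x ^ 2) + 2 * e * (1 / x ^ 4 - 3 * q * x)
    = 5 * (1 + 2 * (q * d * e)) + 6 * (d / x) + 2 * (q * d * x ^ 4) + 2 * (d / x) ^ 2 - q * d ^ 2 * x ^ 3
      + q * e ^ 2 / x ^ 3 + 2 * (q * e * x) ^ 2 + 2 * (e / x ^ 4) - 6 * (q * e * x)"
    by (simp add: algebra_simps power_divide power_mult_distrib power2_eq_square)
  also have "\<dots> = 5 * (1 + q * d * e) ^ 2"
  proof -
    define u v where "u = 1 / (1 - k)" and "v = 1 / (1 + k)"
    have uv: "u * (1 - k) = 1" "v * (1 + k) = 1" using k1 k2 by (simp_all add: u_def v_def)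
    have "5 * (1 + 2 * (- 4 * k * u * v)) + 6 * (- 2 * u) + 2 * (- 2 * k * (1 - k) * v ^ 2) + 2 * (- 2 * u) ^ 2
      - 4 * k * v ^ 2 + 4 * k * u ^ 2 + 2 * (2 * k * v) ^ 2 + 2 * (2 * (1 + k) * u ^ 2) - 6 * (2 * k * v)
      = 5 * (1 + - 4 * k * u * v) ^ 2"
      using uv by algebra
    thus ?thesis unfolding qde dx dx4 d2x3 e2x3 ex4 qex u_def v_def by (simp add: power_divide)
  qed
  finally show "5 * (1 + 2 * q * d * e) + 2 * d * (3 / x + q * x ^ 4) + d ^ 2 * (2 / x ^ 2 - q * x ^ 3)
      + q * e ^ 2 * (1 / x ^ 3 + 2 * q * x ^ 2) + 2 * e * (1 / x ^ 4 - 3 * q * x) = 5 * (1 + q * d * e) ^ 2" .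
  have s1: "s * y ^ 2 = x * (1 + k)"
    using s nz by (simp add: field_simps k_def power2_eq_square)
  have s1': "s = r * x ^ 2 * (1 + k)"
    using s1 rx by algebra
  have t1: "t = (1 - k) / x ^ 2"
    using t nz by (simp add: field_simps k_def power2_eq_square) 
  have "t * x ^ 2 = 1 - k" unfolding t1 using nz by simp
  hence st: "s * t = r * (1 - k ^ 2)" unfolding s1' by algebra
  show "1 / x ^ 5 - 11 * q - q ^ 2 * x ^ 5 = (1 + q * d * e) ^ 2 * (s * t + q)"
  proof -
    define u v where "u = 1 / (1 - k)" and "v = 1 / (1 + k)"
    have uv: "u * (1 - k) = 1" "v * (1 + k) = 1" using k1 k2 by (simp_all add: u_def v_def)
    have "q ^ 2 * x ^ 5 = k ^ 2 * r * (r * x ^ 5)" unfolding q by algebra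
    hence 1: "q ^ 2 * x ^ 5 = k ^ 2 * r * ((1 - k) ^ 2 * v ^ 2)"
      unfolding x5 v_def by (simp add: power_divide)
    have "r * (1 + k) ^ 2 * u ^ 2 - 11 * (k * r) - k ^ 2 * r * ((1 - k) ^ 2 * v ^ 2)
      = (1 + - 4 * k * u * v) ^ 2 * (r * (1 - k ^ 2) + k * r)"
      using uv by algebra
    thus ?thesis unfolding 1 ix5 st qde unfolding q u_def v_def by (simp add: power_divide)
  qed
  have s5: "s ^ 5 = r ^ 3 * (1 - k) ^ 4 * (1 + k)"
  proof -
    define v where "v = 1 / (1 + k)"
    have v: "v * (1 + k) = 1" using k2 by (simp add: v_def)
    have 1: "r * x ^ 5 = (1 - k) ^ 2 * v ^ 2" unfolding x5 v_def by (simp add: power_divide)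
    have "s ^ 5 = r ^ 3 * (r * x ^ 5) ^ 2 * (1 + k) ^ 5" unfolding s1' by algebra
    thus ?thesis unfolding 1 using v by algebra
  qed
  have t5: "t ^ 5 = r ^ 2 * (1 - k) * (1 + k) ^ 4"
  proof -
    define u where "u = 1 / (1 - k)"
    have u: "u * (1 - k) = 1" using k1 by (simp add: u_def)
    have 1: "1 / x ^ 5 = r * (1 + k) ^ 2 * u ^ 2" unfolding ix5 u_def by (simp add: power_divide)
    have "t ^ 5 = (1 - k) ^ 5 * (1 / x ^ 5) ^ 2" unfolding t1 by (simp add: power_divide flip: power_mult)
    thus ?thesis unfolding 1 using u by algebra
  qed
  have "s ^ 5 + q * t ^ 5 + q ^ 3 + 5 * q * s ^ 2 * t ^ 2 - 5 * q ^ 2 * s * t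
      = s ^ 5 + q * t ^ 5 + q ^ 3 + 5 * q * (s * t) ^ 2 - 5 * q ^ 2 * (s * t)"
    by algebra
  also have "\<dots> = (s * t + q) ^ 3"
    unfolding s5 t5 st unfolding q by algebra
  finally show "s ^ 5 + q * t ^ 5 + q ^ 3 + 5 * q * s ^ 2 * t ^ 2 - 5 * q ^ 2 * s * t = (s * t + q) ^ 3" .
qed

text \<open>The homogeneous form of \<open>quintic_parametrization\<close>: for
  \<open>x = W / V\<close> and \<open>y = W2 / V2\<close> the relations in \<open>UW\<close> give
  \<open>1 / x = U / V\<close> and \<open>1 / y = U2 / V2\<close>; the other letters are divided by
  \<open>g\<close> or \<open>p\<close>.\<close>

lemma quintic_relations_field:
  fixes U V W U2 V2 W2 g D E A B p q :: "'a :: field"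
  assumes nz: "(2 :: 'a) \<noteq> 0" "V \<noteq> 0" "W \<noteq> 0" "V2 \<noteq> 0" "W2 \<noteq> 0" "g \<noteq> 0" "p \<noteq> 0"
    and UW: "U * W = V ^ 2" "U2 * W2 = V2 ^ 2" and gp: "g * V2 = V ^ 2" "p * V = V2 ^ 2"
    and D: "D * U2 - q * E * V2 = - 2 * U * V" "- D * V2 - q * E * W2 = 2 * V * W"
      "E * U2 - g * W2 = W ^ 2"
    and A: "A * U - q * p * W = U2 ^ 2" "p * U - B * W = q * W2 ^ 2"
  shows "(5 * V ^ 4 * (g ^ 2 + 2 * q * D * E) + 2 * g * D * (3 * U * V ^ 3 + q * W ^ 4)
      + D ^ 2 * (2 * U ^ 2 * V ^ 2 - q * V * W ^ 3) + q * E ^ 2 * (U ^ 3 * V + 2 * q * V ^ 2 * W ^ 2)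
      + 2 * g * E * (U ^ 4 - 3 * q * V ^ 3 * W)) * g ^ 2 = 5 * V ^ 4 * (g ^ 2 + q * D * E) ^ 2"
    and "(U ^ 5 - 11 * q * V ^ 5 - q ^ 2 * W ^ 5) * g ^ 4 * p ^ 2
      = V ^ 5 * (g ^ 2 + q * D * E) ^ 2 * (A * B + q * p ^ 2)"
    and "p * (A ^ 5 + q * B ^ 5 + q ^ 3 * p ^ 5 + 5 * q * A ^ 2 * B ^ 2 * p - 5 * q ^ 2 * A * B * p ^ 3)
      = (A * B + q * p ^ 2) ^ 3"
proof -
  define x y d e s t where "x = W / V" and "y = W2 / V2" and "d = D / g" and "e = E / g"
    and "s = A / p" and "t = B / p"
  have xy: "x \<noteq> 0" "y \<noteq> 0" using nz by (simp_all add: x_def y_def)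
  define i where "i = 1 / x"
  have ix: "1 / x = U / V" using UW nz by (simp add: x_def field_simps power2_eq_square)
  have iy: "1 / y = U2 / V2" using UW nz by (simp add: y_def field_simps power2_eq_square)
  have g': "g = V ^ 2 / V2" using gp nz by (simp add: field_simps)
  have p': "p = V2 ^ 2 / V" using gp nz by (simp add: field_simps)
  have 1: "d / y - q * e = - 2 / x"
  proof -
    have "d / y - q * e = d * (1 / y) - q * e" by simp
    also have "\<dots> = (D * U2 - q * E * V2) / (g * V2)"
      unfolding iy d_def e_def using nz by (simp add: field_simps)
    also have "\<dots> = - 2 * (1 / x)"
      unfolding D gp ix using nz by (simp add: field_simps power2_eq_square)
    finally show ?thesis by simp
  qed
  have 2: "- d - q * e * y = 2 * x"
  proof -
    have "- d - q * e * y = (- D * V2 - q * E * W2) / (g * V2)"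
      unfolding y_def d_def e_def using nz by (simp add: field_simps)
    thus ?thesis unfolding D gp x_def using nz by (simp add: field_simps power2_eq_square)
  qed
  have 3: "e / y - y = x ^ 2"
  proof -
    have "e / y - y = e * (1 / y) - y" by simp
    also have "\<dots> = (E * U2 - g * W2) / (g * V2)"
      unfolding iy e_def y_def using nz UW(2) by (simp add: field_simps power2_eq_square)
    finally show ?thesis unfolding D gp x_def using nz by (simp add: field_simps power2_eq_square)
  qed
  have 4: "s / x - q * x = 1 / y ^ 2"
  proof -
    have "s / x - q * x = s * (1 / x) - q * x" by simp
    also have "\<dots> = (A * U - q * p * W) / (p * V)"
      unfolding ix s_def x_def using nz UW(1) by (simp add: field_simps power2_eq_square)
    also have "\<dots> = (1 / y) ^ 2"
      unfolding A gp iy by (simp add: power_divide)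
    finally show ?thesis by (simp add: power_one_over)
  qed
  have 5: "1 / x - t * x = q * y ^ 2"
  proof -
    have "1 / x - t * x = (p * U - B * W) / (p * V)"
      unfolding ix t_def x_def using nz UW(1) by (simp add: field_simps power2_eq_square)
    thus ?thesis unfolding A gp y_def by (simp add: power_divide)
  qed
  note P = quintic_parametrization[OF nz(1) xy 1 2 3 4 5]
  have P1: "5 * (1 + 2 * q * d * e) + 2 * d * (3 * i + q * x ^ 4) + d ^ 2 * (2 * i ^ 2 - q * x ^ 3)
      + q * e ^ 2 * (i ^ 3 + 2 * q * x ^ 2) + 2 * e * (i ^ 4 - 3 * q * x) = 5 * (1 + q * d * e) ^ 2"
    using P(1) by (simp add: i_def power_one_over)
  have P2: "i ^ 5 - 11 * q - q ^ 2 * x ^ 5 = (1 + q * d * e) ^ 2 * (s * t + q)"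
    using P(2) by (simp add: i_def power_one_over)
  have sub: "U = V * i" "W = V * x" "D = d * g" "E = e * g" "A = s * p" "B = t * p"
    using nz ix by (simp_all add: i_def x_def d_def e_def s_def t_def)
  show "(5 * V ^ 4 * (g ^ 2 + 2 * q * D * E) + 2 * g * D * (3 * U * V ^ 3 + q * W ^ 4)
      + D ^ 2 * (2 * U ^ 2 * V ^ 2 - q * V * W ^ 3) + q * E ^ 2 * (U ^ 3 * V + 2 * q * V ^ 2 * W ^ 2)
      + 2 * g * E * (U ^ 4 - 3 * q * V ^ 3 * W)) * g ^ 2 = 5 * V ^ 4 * (g ^ 2 + q * D * E) ^ 2"
  proof -
    have "(5 * V ^ 4 * (g ^ 2 + 2 * q * D * E) + 2 * g * D * (3 * U * V ^ 3 + q * W ^ 4)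
      + D ^ 2 * (2 * U ^ 2 * V ^ 2 - q * V * W ^ 3) + q * E ^ 2 * (U ^ 3 * V + 2 * q * V ^ 2 * W ^ 2)
      + 2 * g * E * (U ^ 4 - 3 * q * V ^ 3 * W)) * g ^ 2
      = V ^ 4 * g ^ 4 * (5 * (1 + 2 * q * d * e) + 2 * d * (3 * i + q * x ^ 4) + d ^ 2 * (2 * i ^ 2 - q * x ^ 3)
      + q * e ^ 2 * (i ^ 3 + 2 * q * x ^ 2) + 2 * e * (i ^ 4 - 3 * q * x))"
      unfolding sub by algebra
    also have "\<dots> = 5 * V ^ 4 * (g ^ 2 + q * D * E) ^ 2"
      unfolding P1 sub by algebra
    finally show ?thesis .
  qed
  show "(U ^ 5 - 11 * q * V ^ 5 - q ^ 2 * W ^ 5) * g ^ 4 * p ^ 2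
      = V ^ 5 * (g ^ 2 + q * D * E) ^ 2 * (A * B + q * p ^ 2)"
  proof -
    have "(U ^ 5 - 11 * q * V ^ 5 - q ^ 2 * W ^ 5) * g ^ 4 * p ^ 2
      = V ^ 5 * g ^ 4 * p ^ 2 * (i ^ 5 - 11 * q - q ^ 2 * x ^ 5)"
      unfolding sub by algebra
    also have "\<dots> = V ^ 5 * (g ^ 2 + q * D * E) ^ 2 * (A * B + q * p ^ 2)"
      unfolding P2 sub by algebra
    finally show ?thesis .
  qed
  show "p * (A ^ 5 + q * B ^ 5 + q ^ 3 * p ^ 5 + 5 * q * A ^ 2 * B ^ 2 * p - 5 * q ^ 2 * A * B * p ^ 3)
      = (A * B + q * p ^ 2) ^ 3"
  proof -
    have "p * (A ^ 5 + q * B ^ 5 + q ^ 3 * p ^ 5 + 5 * q * A ^ 2 * B ^ 2 * p - 5 * q ^ 2 * A * B * p ^ 3)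
      = p ^ 6 * (s ^ 5 + q * t ^ 5 + q ^ 3 + 5 * q * s ^ 2 * t ^ 2 - 5 * q ^ 2 * s * t)"
      unfolding sub by algebra
    also have "\<dots> = (A * B + q * p ^ 2) ^ 3"
      unfolding P(3) sub by algebra
    finally show ?thesis .
  qed
qed

lemma to_fract_power: "to_fract (x ^ n) = to_fract x ^ n"
  by (induction n) simp_all

lemma to_fract_numeral: "to_fract (numeral n) = numeral n"
  by (induction n) (simp_all only: numeral.simps to_fract_add to_fract_1)

text \<open>The claims are polynomial, so they descend from the fraction field along the injective
  \<open>to_fract\<close> and become available for \<open>int fps\<close>.\<close>

lemma quintic_relations:
  fixes U V W U2 V2 W2 g D E A B p q :: "'a :: idom"
  assumes nz: "(2 :: 'a) \<noteq> 0" "V \<noteq> 0" "W \<noteq> 0" "V2 \<noteq> 0" "W2 \<noteq> 0" "g \<noteq> 0" "p \<noteq> 0"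
    and UW: "U * W = V ^ 2" "U2 * W2 = V2 ^ 2" and gp: "g * V2 = V ^ 2" "p * V = V2 ^ 2"
    and D: "D * U2 - q * E * V2 = - 2 * U * V" "- D * V2 - q * E * W2 = 2 * V * W"
      "E * U2 - g * W2 = W ^ 2"
    and A: "A * U - q * p * W = U2 ^ 2" "p * U - B * W = q * W2 ^ 2"
  shows "(5 * V ^ 4 * (g ^ 2 + 2 * q * D * E) + 2 * g * D * (3 * U * V ^ 3 + q * W ^ 4)
      + D ^ 2 * (2 * U ^ 2 * V ^ 2 - q * V * W ^ 3) + q * E ^ 2 * (U ^ 3 * V + 2 * q * V ^ 2 * W ^ 2)
      + 2 * g * E * (U ^ 4 - 3 * q * V ^ 3 * W)) * g ^ 2 = 5 * V ^ 4 * (g ^ 2 + q * D * E) ^ 2"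
    and "(U ^ 5 - 11 * q * V ^ 5 - q ^ 2 * W ^ 5) * g ^ 4 * p ^ 2
      = V ^ 5 * (g ^ 2 + q * D * E) ^ 2 * (A * B + q * p ^ 2)"
    and "p * (A ^ 5 + q * B ^ 5 + q ^ 3 * p ^ 5 + 5 * q * A ^ 2 * B ^ 2 * p - 5 * q ^ 2 * A * B * p ^ 3)
      = (A * B + q * p ^ 2) ^ 3"
proof -
  note tf = to_fract_mult[symmetric] to_fract_add[symmetric] to_fract_diff[symmetric]
    to_fract_uminus[symmetric] to_fract_power[symmetric] to_fract_numeral[symmetric]
  note R = quintic_relations_field[of "to_fract V" "to_fract W" "to_fract V2" "to_fract W2" "to_fract g"
      "to_fract p" "to_fract U" "to_fract U2" "to_fract D" "to_fract q" "to_fract E" "to_fract A" "to_fract B",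
      unfolded tf to_fract_eq_iff to_fract_eq_0_iff, OF nz UW gp D A]
  show "(5 * V ^ 4 * (g ^ 2 + 2 * q * D * E) + 2 * g * D * (3 * U * V ^ 3 + q * W ^ 4)
      + D ^ 2 * (2 * U ^ 2 * V ^ 2 - q * V * W ^ 3) + q * E ^ 2 * (U ^ 3 * V + 2 * q * V ^ 2 * W ^ 2)
      + 2 * g * E * (U ^ 4 - 3 * q * V ^ 3 * W)) * g ^ 2 = 5 * V ^ 4 * (g ^ 2 + q * D * E) ^ 2"
    by (rule R(1))
  show "(U ^ 5 - 11 * q * V ^ 5 - q ^ 2 * W ^ 5) * g ^ 4 * p ^ 2
      = V ^ 5 * (g ^ 2 + q * D * E) ^ 2 * (A * B + q * p ^ 2)"
    by (rule R(2))
  show "p * (A ^ 5 + q * B ^ 5 + q ^ 3 * p ^ 5 + 5 * q * A ^ 2 * B ^ 2 * p - 5 * q ^ 2 * A * B * p ^ 3)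
      = (A * B + q * p ^ 2) ^ 3"
    by (rule R(3))
qed

section \<open>Theta series\<close>

declare One_nat_def [simp del]

lemma dil_numeral_mult [simp]: "dil k (numeral c * f) = numeral c * dil k f"
  unfolding fps_numeral_fps_const by simp

definition psi :: "int fps" where
  "psi = euler_f 2 ^ 2 * inv_fps (euler_f 1)"

definition phi :: "int fps" where
  "phi = euler_f 1 ^ 2 * inv_fps (euler_f 2)"

lemma euler_f_neq_0 [simp]: "m > 0 \<Longrightarrow> euler_f m \<noteq> 0"
  using euler_f_nth_0[of m] by auto

lemma psi_mult: "psi * euler_f 1 = euler_f 2 ^ 2"
  using inv_fps[OF euler_f_nth_0[of 1]] by (simp add: psi_def mult.assoc mult.commute[of "inv_fps _"])

lemma phi_mult: "phi * euler_f 2 = euler_f 1 ^ 2"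
  using inv_fps[OF euler_f_nth_0[of 2]] by (simp add: phi_def mult.assoc mult.commute[of "inv_fps _"])

lemma psi_nth_0 [simp]: "fps_nth psi 0 = 1"
  by (simp add: psi_def fps_nth_power_0 euler_f_nth_0)

lemma phi_nth_0 [simp]: "fps_nth phi 0 = 1"
  by (simp add: phi_def fps_nth_power_0 euler_f_nth_0)

lemma psi_neq_0 [simp]: "psi \<noteq> 0" and phi_neq_0 [simp]: "phi \<noteq> 0"
  using psi_nth_0 phi_nth_0 by force+

lemma psi_theta: "2 * psi = theta (tsgn 1) (texp 0 1)"
proof -
  have "2 * psi * euler_f 1 = theta (tsgn 1) (texp 0 1) * euler_f 1"
    using psi_mult theta_tri by (simp add: mult.assoc)
  thus ?thesis by simp
qed

lemma phi_theta: "phi = theta (tsgn (-1)) (texp 1 1)"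
proof -
  have "phi * euler_f 2 = theta (tsgn (-1)) (texp 1 1) * euler_f 2"
    using phi_mult theta_sq by simp
  thus ?thesis by simp
qed

text \<open>Completes the square: \<open>8 * (i * (i - 1) / 2) + 1 = (2 * i - 1)^2\<close>.\<close>

lemma theta_texp_0_1: "theta c (texp 0 1) = sq_series 8 1 (\<lambda>x. c ((x + 1) div 2))"
proof (rule fps_ext)
  fix n
  have "(\<Sum>i | texp 0 1 i = n. c i) = (\<Sum>x | x^2 = int (8 * n + 1). c ((x + 1) div 2))"
  proof (rule sum.reindex_bij_witness[where i = "\<lambda>x. (x + 1) div 2" and j = "\<lambda>i. 2 * i - 1"])
    fix i assume "i \<in> {i. texp 0 1 i = n}"
    hence "2 * int n = i * (i - 1)" using texp[of 0 1 i] by simp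
    hence "(2 * i - 1)^2 = 8 * int n + 1" by (simp add: power2_eq_square algebra_simps)
    thus "2 * i - 1 \<in> {x. x^2 = int (8 * n + 1)}" by simp
  next
    fix x :: int assume "x \<in> {x. x^2 = int (8 * n + 1)}"
    hence x: "x^2 = 8 * int n + 1" by simp
    hence "odd (x^2)" by simp
    hence "odd x" by simp
    then obtain k where k: "x = 2 * k + 1" by (elim oddE)
    have "2 * int (texp 0 1 (k + 1)) = 2 * int n"
      using x texp[of 0 1 "k + 1"] unfolding k by (simp add: power2_eq_square algebra_simps)
    thus "(x + 1) div 2 \<in> {i. texp 0 1 i = n}" "2 * ((x + 1) div 2) - 1 = x"
      by (simp_all add: k add.commute)
  qed auto
  thus "fps_nth (theta c (texp 0 1)) n = fps_nth (sq_series 8 1 (\<lambda>x. c ((x + 1) div 2))) n"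
    by (simp add: theta_def sq_series_def)
qed

lemma theta_texp_1_1: "theta c (texp 1 1) = sq_series 1 0 c"
proof -
  have "texp 1 1 i = n \<longleftrightarrow> i^2 = int n" for i n
    using texp[of 1 1 i] by (auto simp: power2_eq_square algebra_simps)
  thus ?thesis by (simp add: theta_def sq_series_def)
qed

text \<open>For odd \<open>x\<close> this is \<open>x\<close> times the nontrivial character modulo
  4, hence an even function of \<open>x\<close>.\<close>

definition cube_weight :: "int \<Rightarrow> int" where
  "cube_weight x = - x * tsgn (-1) ((x + 1) div 2)"

lemma psi_sq_series: "2 * psi = sq_series 8 1 (\<lambda>_. 1)"
  unfolding psi_theta theta_texp_0_1 by (simp add: tsgn_def)

lemma phi_sq_series: "phi = sq_series 1 0 (tsgn (-1))"
  unfolding phi_theta theta_texp_1_1 ..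

text \<open>Averaging over the reflection \<open>i \<mapsto> 1 - i\<close> turns the weight \<open>i\<close> into \<open>(2 i - 1) / 2\<close>.\<close>

lemma cube_sq_series: "2 * euler_f 1 ^ 3 = sq_series 8 1 cube_weight"
proof -
  define c where "c = (\<lambda>i. i * tsgn (-1) i)"
  have "theta c (texp 0 1) = theta (\<lambda>i. c (1 - i)) (texp 0 1)"
    unfolding theta_def
  proof (rule arg_cong[of _ _ Abs_fps], rule ext)
    fix n
    have *: "texp 0 1 (1 - i) = texp 0 1 i" for i
      by (simp add: texp_def algebra_simps)
    show "(\<Sum>i | texp 0 1 i = n. c i) = (\<Sum>i | texp 0 1 i = n. c (1 - i))"
      by (rule sum.reindex_bij_witness[where i = "\<lambda>i. 1 - i" and j = "\<lambda>i. 1 - i"]) (auto simp: *)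
  qed
  hence "2 * theta c (texp 0 1) = theta c (texp 0 1) + theta (\<lambda>i. c (1 - i)) (texp 0 1)"
    unfolding mult_2 by (rule arg_cong)
  also have "\<dots> = theta (\<lambda>i. c i + c (1 - i)) (texp 0 1)"
    by (simp add: theta_def fps_eq_iff sum.distrib)
  also have "(\<lambda>i. c i + c (1 - i)) = (\<lambda>i. (2 * i - 1) * tsgn (-1) i)"
    by (auto simp: c_def tsgn_def algebra_simps)
  finally have t: "2 * theta c (texp 0 1) = theta (\<lambda>i. (2 * i - 1) * tsgn (-1) i) (texp 0 1)" .
  have "theta c (texp 0 1) = - (euler_f 1 ^ 3)"
    unfolding c_def by (rule theta_cube)
  hence "2 * euler_f 1 ^ 3 = - (2 * theta c (texp 0 1))" by simp
  also have "\<dots> = - theta (\<lambda>i. (2 * i - 1) * tsgn (-1) i) (texp 0 1)"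
    unfolding t ..
  also have "\<dots> = theta (\<lambda>i. - (2 * i - 1) * tsgn (-1) i) (texp 0 1)"
    unfolding theta_def by (rule fps_ext) (simp only: fps_neg_nth fps_nth_Abs_fps sum_negf[symmetric] mult_minus_left)
  also have "\<dots> = sq_series 8 1 cube_weight"
    unfolding theta_texp_0_1 sq_series_def cube_weight_def
  proof (rule arg_cong[of _ _ Abs_fps], rule ext, rule sum.cong[OF refl])
    fix n x assume "x \<in> {x. x^2 = int (8 * n + 1)}"
    hence "x^2 = 8 * int n + 1" by simp
    hence "odd (x^2)" by simp
    hence "odd x" by simp
    hence "2 * ((x + 1) div 2) - 1 = x" by presburger
    thus "- (2 * ((x + 1) div 2) - 1) * tsgn (-1) ((x + 1) div 2) = - x * tsgn (-1) ((x + 1) div 2)"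
      by simp
  qed
  finally show ?thesis .
qed

section \<open>Components modulo 5 of the theta series\<close>

lemma square_mod_5: "(x :: int)^2 mod 5 \<in> {0, 1, 4}"
proof -
  have "x mod 5 \<in> {0, 1, 2, 3, 4}" by auto
  hence "(x mod 5)^2 mod 5 \<in> {0, 1, 4}" by auto
  thus ?thesis by (simp add: power_mod)
qed

lemma sq_series_sect_eq_0:
  assumes "int (K * r + L) mod 5 \<in> {2, 3}"
  shows "sect r (sq_series K L u) = 0"
proof (rule fps_ext)
  fix n
  have "x^2 \<noteq> int (K * (5 * n + r) + L)" for x :: int
  proof
    assume "x^2 = int (K * (5 * n + r) + L)"
    also have "\<dots> = int (K * r + L) + 5 * int (K * n)" by (simp add: algebra_simps)
    finally have "x^2 mod 5 = int (K * r + L) mod 5" by simp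
    thus False using square_mod_5[of x] assms by auto
  qed
  hence "{x :: int. x^2 = int (K * (5 * n + r) + L)} = {}" by blast
  thus "fps_nth (sect r (sq_series K L u)) n = fps_nth 0 n"
    by (simp only: sect_nth sq_series_def fps_nth_Abs_fps fps_zero_nth sum.empty)
qed

text \<open>The condition on \<open>r\<close> picks the class in which 5 divides \<open>x^2\<close>.
  Then \<open>x = 5 y\<close>, and the exponent \<open>m\<close> belonging to \<open>y\<close>
  becomes \<open>25 * m + r\<close>.\<close>

lemma sq_series_sect_dil:
  assumes KL: "sq_modulus K L" "K * r + L = 25 * L" and u: "\<And>x. u (5 * x) = u x"
  shows "sect r (sq_series K L u) = dil 5 (sq_series K L u)"
proof (rule fps_ext)
  fix n
  have e: "int (K * (5 * n + r) + L) = 5 * int (K * n + 5 * L)"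
  proof -
    have "K * (5 * n + r) + L = 5 * (K * n + 5 * L)" using KL(2) by (simp add: algebra_simps)
    thus ?thesis by (metis of_nat_mult of_nat_numeral)
  qed
  have dvd: "5 dvd x" if "x^2 = 5 * int (K * n + 5 * L)" for x :: int
  proof -
    have "5 dvd x^2" unfolding that by simp
    thus ?thesis by (simp add: prime_dvd_power_iff)
  qed
  show "fps_nth (sect r (sq_series K L u)) n = fps_nth (dil 5 (sq_series K L u)) n"
  proof (cases "5 dvd n")
    case True
    then obtain m where m: "n = 5 * m" ..
    define M where "M = int (K * m + L)"
    have e': "int (K * (5 * n + r) + L) = 25 * M"
      by (subst e) (simp add: M_def m algebra_simps)
    have "(\<Sum>x | x^2 = 25 * M. u x) = (\<Sum>x | x^2 = M. u x)"
    proof (rule sum.reindex_bij_witness[where i = "\<lambda>x. 5 * x" and j = "\<lambda>x. x div 5"])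
      fix x assume "x \<in> {x. x^2 = 25 * M}"
      moreover from this have "5 dvd x" using dvd[of x] e e' by simp
      ultimately obtain y where "x = 5 * y" "(5 * y)^2 = 25 * M" by blast
      thus "5 * (x div 5) = x" "x div 5 \<in> {x. x^2 = M}" "u (x div 5) = u x"
        by (auto simp: power_mult_distrib u)
    qed (auto simp: power_mult_distrib)
    thus ?thesis
      unfolding sect_nth sq_series_def fps_nth_Abs_fps e' by (simp add: m dil_nth M_def)
  next
    case False
    have "{x :: int. x^2 = 5 * int (K * n + 5 * L)} = {}"
    proof safe
      fix x :: int assume x: "x^2 = 5 * int (K * n + 5 * L)"
      from dvd[OF x] obtain y where "x = 5 * y" ..
      with x have "int (K * n + 5 * L) = 5 * y^2" by (simp add: power_mult_distrib)
      hence "int (K * n + 5 * L) mod 5 = 0" by simp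
      hence "5 dvd n" using KL(1) by (auto simp: sq_modulus_def) presburger+
      thus "x \<in> {}" using False by simp
    qed
    thus ?thesis unfolding sect_nth sq_series_def fps_nth_Abs_fps e
      by (simp only: sum.empty) (simp add: dil_nth False)
  qed
qed

lemma sq_moduli [simp]: "sq_modulus 8 1" "sq_modulus 1 0"
  by (simp_all add: sq_modulus_def)

lemma two_fps_cancel: "2 * f = 2 * g \<Longrightarrow> f = (g :: int fps)"
  by simp

lemma sect_psi: "sect 2 psi = 0" "sect 3 psi = dil 5 psi" "sect 4 psi = 0"
proof -
  have e: "2 * sect r psi = sect r (sq_series 8 1 (\<lambda>_. 1))" for r
    by (simp flip: psi_sq_series)
  show "sect 2 psi = 0" "sect 4 psi = 0"
    using e[of 2] e[of 4] by (simp_all add: sq_series_sect_eq_0)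
  have "2 * sect 3 psi = dil 5 (2 * psi)"
    unfolding e psi_sq_series by (rule sq_series_sect_dil) simp_all
  thus "sect 3 psi = dil 5 psi"
    unfolding dil_numeral_mult by (rule two_fps_cancel)
qed

lemma sect_phi: "sect 0 phi = dil 5 phi" "sect 2 phi = 0" "sect 3 phi = 0"
  unfolding phi_sq_series
  by (rule sq_series_sect_dil; simp add: tsgn_def) (rule sq_series_sect_eq_0; simp)+

lemma sect_cube: "sect 2 (euler_f 1 ^ 3) = 0" "sect 4 (euler_f 1 ^ 3) = 0"
proof -
  have "2 * sect r (euler_f 1 ^ 3) = sect r (sq_series 8 1 cube_weight)" for r
    by (simp flip: cube_sq_series)
  from this[of 2] this[of 4] show "sect 2 (euler_f 1 ^ 3) = 0" "sect 4 (euler_f 1 ^ 3) = 0"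
    by (simp_all add: sq_series_sect_eq_0)
qed

lemma fps_numeral_dvd_iff:
  fixes f :: "int fps"
  shows "numeral c dvd f \<longleftrightarrow> (\<forall>n. numeral c dvd fps_nth f n)"
proof
  assume "numeral c dvd f"
  thus "\<forall>n. numeral c dvd fps_nth f n"
    by (auto simp: fps_numeral_fps_const elim!: dvdE)
next
  assume "\<forall>n. numeral c dvd fps_nth f n"
  hence "f = numeral c * Abs_fps (\<lambda>n. fps_nth f n div numeral c)"
    by (simp add: fps_eq_iff fps_numeral_fps_const)
  thus "numeral c dvd f" by (rule dvdI)
qed

lemma sect_dvd: "numeral c dvd f \<Longrightarrow> numeral c dvd sect r f"
  by (simp add: fps_numeral_dvd_iff sect_nth)

text \<open>In class 3 the index \<open>x\<close> is divisible by 5, and \<open>cube_weight\<close>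
  has the factor \<open>x\<close>; the 2 in \<open>cube_sq_series\<close> is harmless modulo
  5.\<close>

lemma five_dvd_sect_cube: "5 dvd sect 3 (euler_f 1 ^ 3)"
proof -
  have "5 dvd fps_nth (sect 3 (euler_f 1 ^ 3)) n" for n
  proof -
    have "5 dvd x" if "x^2 = int (8 * (5 * n + 3) + 1)" for x
    proof -
      have "x^2 = 5 * (8 * int n + 5)" using that by simp
      hence "5 dvd x^2" by simp
      thus ?thesis by (simp add: prime_dvd_power_iff)
    qed
    hence "5 dvd (\<Sum>x | x^2 = int (8 * (5 * n + 3) + 1). cube_weight x)"
      by (intro dvd_sum) (auto simp: cube_weight_def)
    also have "\<dots> = 2 * fps_nth (sect 3 (euler_f 1 ^ 3)) n"
      using arg_cong[OF cube_sq_series, of "\<lambda>f. fps_nth f (5 * n + 3)"]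
      by (simp add: sect_nth sq_series_def fps_numeral_fps_const)
    finally show ?thesis by presburger
  qed
  thus ?thesis by (simp add: fps_numeral_dvd_iff)
qed

text \<open>The constant weight satisfies the hypothesis of \<open>sq_series_hecke\<close>;
  comparison with component 1 of the square as computed by \<open>sect_mult\<close> gives the
  relation.\<close>

lemma psi_hecke: "psi ^ 2 = sect 0 psi * sect 1 psi + fps_X * dil 5 psi ^ 2"
proof -
  have "sect 1 (2 * psi * (2 * psi)) = 2 * (2 * psi * (2 * psi)) - fps_X ^ 1 * dil 5 (2 * psi * (2 * psi))"
    unfolding psi_sq_series by (rule sq_series_hecke) simp_all
  moreover have "2 * psi * (2 * psi) = 4 * psi ^ 2"
    by (simp add: power2_eq_square)
  ultimately have "4 * sect 1 (psi ^ 2) = 2 * (4 * psi ^ 2) - fps_X * (4 * dil 5 psi ^ 2)"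
    by simp
  moreover have "sect 1 (psi ^ 2) = 2 * (sect 0 psi * sect 1 psi) + fps_X * dil 5 psi ^ 2"
    by (simp add: power2_eq_square sect_mult sect_psi)
  ultimately have "8 * psi ^ 2 = 8 * (sect 0 psi * sect 1 psi + fps_X * dil 5 psi ^ 2)"
    by algebra
  thus ?thesis by (simp only: mult_cancel_left) simp
qed

text \<open>Modulo 2, multiplication by \<open>2 + i\<close> or \<open>2 - i\<close> swaps the
  coordinates, so the product of the two signs is preserved.\<close>

lemma phi_hecke: "phi ^ 2 = dil 5 phi ^ 2 + fps_X * sect 1 phi * sect 4 phi"
proof -
  have "sect 0 (phi * phi) = 2 * (phi * phi) - fps_X ^ 0 * dil 5 (phi * phi)"
    unfolding phi_sq_series by (rule sq_series_hecke) (auto simp: tsgn_def)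
  moreover have "sect 0 (phi * phi) = dil 5 phi ^ 2 + 2 * (fps_X * sect 1 phi * sect 4 phi)"
    by (simp add: power2_eq_square sect_mult sect_phi algebra_simps)
  ultimately have "2 * phi ^ 2 = 2 * (dil 5 phi ^ 2 + fps_X * sect 1 phi * sect 4 phi)"
    by (simp add: power2_eq_square algebra_simps)
  thus ?thesis by (rule two_fps_cancel)
qed

text \<open>For odd coordinates the two images of a point contribute
  \<open>- 2 * cube_weight x\<close>, and swapping the coordinates restores the weight on
  \<open>y\<close>. Points with both coordinates divisible by 5 carry weights divisible by
  5.\<close>

lemma psi_cube_hecke: "5 dvd sect 1 (psi * euler_f 1 ^ 3) + 2 * (psi * euler_f 1 ^ 3)"
proof -
  let ?P = "sq_series 8 1 (\<lambda>_. 1) * sq_series 8 1 cube_weight"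
  have P: "?P = 4 * (psi * euler_f 1 ^ 3)"
    by (simp flip: psi_sq_series cube_sq_series)
  have w: "cube_weight (x + 2 * y) + cube_weight (2 * y - x) = - 2 * cube_weight x"
    if xy: "x^2 + y^2 = int (8 * n + 2 * 1)" for x y n
  proof -
    obtain i j where "x^2 = int (8 * i + 1)" "y^2 = int (8 * j + 1)" "i + j = n"
      by (rule sq_modulus_split[OF sq_moduli(1) xy])
    hence "odd (x^2)" "odd (y^2)" by simp_all
    hence "odd x" "odd y" by simp_all
    then obtain k l where kl: "x = 2 * k + 1" "y = 2 * l + 1" by (auto elim!: oddE)
    have e: "(x + 2 * y + 1) div 2 = k + 2 * l + 2" "(2 * y - x + 1) div 2 = 2 * l + 1 - k"
      "(x + 1) div 2 = k + 1" by (simp_all add: kl)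
    show ?thesis unfolding cube_weight_def e by (simp add: tsgn_def algebra_simps)
  qed
  have "5 dvd fps_nth (sect 1 ?P + 2 * ?P) n" for n
  proof -
    have "(\<Sum>(x, y)\<in>circ (int (8 * n + 2 * 1)). 1 * cube_weight (x + 2 * y) + 1 * cube_weight (2 * y - x))
        = (\<Sum>(x, y)\<in>circ (int (8 * n + 2 * 1)). - 2 * cube_weight x)"
    proof (intro sum.cong refl, clarify)
      fix x y assume "(x, y) \<in> circ (int (8 * n + 2 * 1))"
      hence "x^2 + y^2 = int (8 * n + 2 * 1)" by (simp only: circ_def mem_Collect_eq prod.case)
      from w[OF this] show "1 * cube_weight (x + 2 * y) + 1 * cube_weight (2 * y - x) = - 2 * cube_weight x"
        by simp
    qed
    also have "\<dots> = (\<Sum>(x, y)\<in>circ (int (8 * n + 2 * 1)). - 2 * (1 * cube_weight y))"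
      by (rule sum.reindex_bij_witness[where i = "\<lambda>(x, y). (y, x)" and j = "\<lambda>(x, y). (y, x)"])
         (auto simp: circ_def add.commute)
    also have "\<dots> = - 2 * fps_nth ?P n"
      unfolding sq_series_mult_nth[OF sq_moduli(1)] sum_distrib_left by (intro sum.cong) auto
    finally have "fps_nth (sect 1 ?P + 2 * ?P) n =
        - (\<Sum>(x, y)\<in>{(x, y)\<in>circ (5 * int (8 * n + 2 * 1)). 5 dvd x \<and> 5 dvd y}. 1 * cube_weight y)"
      unfolding fps_add_nth sq_series_mult_sect_nth[OF sq_moduli(1)]
      by (simp add: fps_numeral_fps_const)
    also have "5 dvd \<dots>"
      unfolding dvd_minus_iff by (intro dvd_sum) (auto simp: cube_weight_def)
    finally show ?thesis .
  qed
  hence "5 dvd sect 1 ?P + 2 * ?P" by (simp only: fps_numeral_dvd_iff simp_thms)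
  moreover have "sect 1 ?P + 2 * ?P = 4 * (sect 1 (psi * euler_f 1 ^ 3) + 2 * (psi * euler_f 1 ^ 3))"
    unfolding P sect_numeral_mult by algebra
  ultimately have "5 dvd 4 * (sect 1 (psi * euler_f 1 ^ 3) + 2 * (psi * euler_f 1 ^ 3))"
    by simp
  hence "\<forall>n. 5 dvd 4 * fps_nth (sect 1 (psi * euler_f 1 ^ 3) + 2 * (psi * euler_f 1 ^ 3)) n"
    unfolding fps_numeral_dvd_iff by (simp add: fps_numeral_fps_const)
  moreover have "5 dvd m" if "5 dvd 4 * m" for m :: int using that by presburger
  ultimately show ?thesis unfolding fps_numeral_dvd_iff by blast
qed

text \<open>The exponents \<open>(3 * i^2 - i) / 2\<close> meet only the classes 0, 1, 2 modulo 5,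
  and class 1 only for \<open>i\<close> congruent to 1. There \<open>i = 1 - 5 * j\<close> has the
  exponent 1 plus 25 times that of \<open>j\<close>, and the opposite sign.\<close>

lemma sect_euler_1:
  "sect 1 (euler_f 1) = - dil 5 (euler_f 1)" "sect 3 (euler_f 1) = 0" "sect 4 (euler_f 1) = 0"
proof -
  have t: "2 * int (texp 1 2 i) = 3 * i^2 - i" for i
    using texp[of 1 2 i] by (simp add: power2_eq_square algebra_simps)
  have m: "(3 * i^2 - i) mod 5 \<in> {0, 2, 4} \<and> ((3 * i^2 - i) mod 5 = 2 \<longrightarrow> i mod 5 = 1)" for i :: int
  proof -
    have e: "(3 * i^2 - i) mod 5 = (3 * (i mod 5)^2 - i mod 5) mod 5"
      by (metis mod_diff_cong mod_mod_trivial mod_mult_right_eq power_mod)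
    have "i mod 5 \<in> {0, 1, 2, 3, 4}" by auto
    thus ?thesis unfolding e by auto
  qed
  have z: "sect r (euler_f 1) = 0" if "(2 * int r) mod 5 \<in> {1, 3}" for r
  proof (rule fps_ext)
    fix n
    have "texp 1 2 i \<noteq> 5 * n + r" for i
    proof
      assume "texp 1 2 i = 5 * n + r"
      hence "3 * i^2 - i = 2 * int r + 5 * (2 * int n)" using t[of i] by simp
      hence "(3 * i^2 - i) mod 5 = 2 * int r mod 5" by (simp only: mod_mult_self2)
      thus False using m[of i] that by auto
    qed
    hence "{i. texp 1 2 i = 5 * n + r} = {}" by blast
    thus "fps_nth (sect r (euler_f 1)) n = fps_nth 0 n"
      by (simp add: sect_nth pentagonal_theta theta_def)
  qed
  show "sect 3 (euler_f 1) = 0" "sect 4 (euler_f 1) = 0" by (rule z; simp)+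
  show "sect 1 (euler_f 1) = - dil 5 (euler_f 1)"
  proof (rule fps_ext)
    fix n
    have "(\<Sum>i | texp 1 2 i = 5 * n + 1. tsgn (-1) i) =
      (\<Sum>j | 5 * texp 1 2 j = n. - tsgn (-1) j)"
    proof (rule sum.reindex_bij_witness[where i = "\<lambda>j. 1 - 5 * j" and j = "\<lambda>i. (1 - i) div 5"])
      fix i assume "i \<in> {i. texp 1 2 i = 5 * n + 1}"
      hence i: "3 * i^2 - i = 2 + 5 * (2 * int n)" using t[of i] by simp
      have "(2 + 5 * (2 * int n)) mod 5 = 2" by presburger
      hence "(3 * i^2 - i) mod 5 = 2" unfolding i .
      hence "i mod 5 = 1" using m[of i] by auto
      hence "5 dvd 1 - i" by presburger
      then obtain j where j: "i = 1 - 5 * j" by (metis dvd_def diff_diff_eq2 diff_add_cancel add_diff_cancel_left' add.commute)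
      have "2 * int (5 * texp 1 2 j) = 2 * int n"
        using i t[of j] by (simp add: j power2_eq_square algebra_simps)
      thus "1 - 5 * ((1 - i) div 5) = i" "(1 - i) div 5 \<in> {j. 5 * texp 1 2 j = n}"
        "- tsgn (-1) ((1 - i) div 5) = tsgn (-1) i"
        by (simp_all add: j tsgn_def)
    next
      fix j assume j: "j \<in> {j. 5 * texp 1 2 j = n}"
      have "2 * int (texp 1 2 (1 - 5 * j)) = 2 * int (5 * n + 1)"
        using j t[of j] t[of "1 - 5 * j"] by (simp add: power2_eq_square algebra_simps)
      thus "(1 - (1 - 5 * j)) div 5 = j" "1 - 5 * j \<in> {i. texp 1 2 i = 5 * n + 1}" by simp_all
    qed
    also have "\<dots> = - fps_nth (dil 5 (euler_f 1)) n"
    proof (cases "5 dvd n")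
      case True
      then obtain k where "n = 5 * k" ..
      thus ?thesis by (simp add: dil_nth pentagonal_theta theta_def sum_negf)
    next
      case False
      hence "{j. 5 * texp 1 2 j = n} = {}" by auto
      thus ?thesis by (simp add: dil_nth False)
    qed
    finally show "fps_nth (sect 1 (euler_f 1)) n = fps_nth (- dil 5 (euler_f 1)) n"
      by (simp add: sect_nth pentagonal_theta theta_def)
  qed
qed

lemma sect_dil_2:
  "sect 0 (dil 2 f) = dil 2 (sect 0 f)" "sect 2 (dil 2 f) = dil 2 (sect 1 f)"
  "sect 4 (dil 2 f) = dil 2 (sect 2 f)"
  "sect 1 (dil 2 f) = fps_X * dil 2 (sect 3 f)" "sect 3 (dil 2 f) = fps_X * dil 2 (sect 4 f)"
proof -
  have d: "(5 * n + 2 * r) div 2 = 5 * (n div 2) + r" if "even n" for n r :: nat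
    using that by (auto elim!: evenE)
  have e: "sect (2 * r) (dil 2 f) = dil 2 (sect r f)" for r
  proof (rule fps_ext)
    fix n show "fps_nth (sect (2 * r) (dil 2 f)) n = fps_nth (dil 2 (sect r f)) n"
      using d[of n r] by (cases "even n") (simp_all add: sect_nth dil_nth)
  qed
  show "sect 0 (dil 2 f) = dil 2 (sect 0 f)" "sect 2 (dil 2 f) = dil 2 (sect 1 f)"
    "sect 4 (dil 2 f) = dil 2 (sect 2 f)"
    using e[of 0] e[of 1] e[of 2] by simp_all
  show "sect 1 (dil 2 f) = fps_X * dil 2 (sect 3 f)"
  proof (rule fps_ext)
    fix n show "fps_nth (sect 1 (dil 2 f)) n = fps_nth (fps_X * dil 2 (sect 3 f)) n"
      using d[of "n - 1" 3] by (cases n) (auto simp: sect_nth dil_nth add.commute)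
  qed
  show "sect 3 (dil 2 f) = fps_X * dil 2 (sect 4 f)"
  proof (rule fps_ext)
    fix n show "fps_nth (sect 3 (dil 2 f)) n = fps_nth (fps_X * dil 2 (sect 4 f)) n"
      using d[of "n - 1" 4] by (cases n) (auto simp: sect_nth dil_nth add.commute)
  qed
qed

lemma dil_commute: "k > 0 \<Longrightarrow> l > 0 \<Longrightarrow> dil k (dil l f) = dil l (dil k f)"
  by (auto simp: fps_eq_iff dil_nth elim!: dvdE)

lemma euler_f_2: "euler_f 2 = dil 2 (euler_f 1)"
  using euler_f_dil[of 2 1] by simp

lemma sect_euler_2:
  "sect 1 (euler_f 2) = 0" "sect 2 (euler_f 2) = - dil 5 (euler_f 2)" "sect 3 (euler_f 2) = 0"
  by (simp_all add: euler_f_2 sect_dil_2 sect_euler_1 dil_commute[of 5 2])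

section \<open>Exact dissections\<close>

lemma mult_left_cancelD: "c * x = c * y \<Longrightarrow> c \<noteq> 0 \<Longrightarrow> x = (y :: 'a :: idom)"
  by simp

lemma eq_dil_5:
  assumes "sect 0 f = m" "sect 1 f = 0" "sect 2 f = 0" "sect 3 f = 0" "sect 4 f = 0"
  shows "f = dil 5 m"
  using dissection[of f] by (simp add: assms)

lemma dil_neq_0: "k > 0 \<Longrightarrow> fps_nth f 0 \<noteq> 0 \<Longrightarrow> dil k f \<noteq> 0"
  using dil_nth_0[of k f] by force

lemma sect_0_neq_0: "fps_nth f 0 \<noteq> 0 \<Longrightarrow> sect 0 f \<noteq> 0"
  using sect_nth[of 0 f 0] by force

text \<open>
  The cube of \<open>euler_f\<close> has no exponents in the class of \<open>2\<close>, which forces this relation between the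
  components of \<open>euler_f\<close> itself.
\<close>

lemma sect_euler_1_relation: "sect 0 (euler_f 1) * sect 2 (euler_f 1) = - (dil 5 (euler_f 1) ^ 2)"
proof -
  define U V W where "U = sect 0 (euler_f 1)" and "V = dil 5 (euler_f 1)" and "W = sect 2 (euler_f 1)"
  have "sect 2 (euler_f 1 * (euler_f 1 * euler_f 1)) = 0"
    using sect_cube(1) by (simp add: power3_eq_cube mult.assoc)
  hence "3 * U * (U * W + V ^ 2) = 0"
    unfolding sect_mult sect_euler_1 U_def[symmetric] V_def[symmetric] W_def[symmetric] by algebra
  moreover have "3 * U \<noteq> 0"
    unfolding U_def using sect_0_neq_0[of "euler_f 1"] euler_f_nth_0[of 1] by simp
  ultimately have "U * W + V ^ 2 = 0" by (simp only: mult_eq_0_iff simp_thms)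
  thus ?thesis by (simp add: U_def V_def W_def add_eq_0_iff)
qed

lemma sect_euler_2_relation: "sect 0 (euler_f 2) * sect 4 (euler_f 2) = - (dil 5 (euler_f 2) ^ 2)"
proof -
  have "sect 0 (euler_f 2) * sect 4 (euler_f 2) = dil 2 (sect 0 (euler_f 1) * sect 2 (euler_f 1))"
    by (simp add: euler_f_2 sect_dil_2)
  thus ?thesis
    unfolding sect_euler_1_relation by (simp add: euler_f_2 dil_commute[of 5 2])
qed

text \<open>The product of \<open>euler_f 1\<close> at \<open>zeta * q\<close> over the fifth roots
  of unity \<open>zeta\<close>, read as a series in \<open>q^5\<close> and simplified by
  \<open>sect_euler_1_relation\<close>. The series \<open>norm_psi\<close> is the analogue for
  \<open>psi\<close>.\<close>

definition norm_euler :: "int fps" where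
  "norm_euler = sect 0 (euler_f 1) ^ 5 - 11 * fps_X * dil 5 (euler_f 1) ^ 5 + fps_X ^ 2 * sect 2 (euler_f 1) ^ 5"

definition norm_psi :: "int fps" where
  "norm_psi = sect 0 psi ^ 5 + fps_X * sect 1 psi ^ 5 + fps_X ^ 3 * dil 5 psi ^ 5
    + 5 * fps_X * sect 0 psi ^ 2 * sect 1 psi ^ 2 * dil 5 psi - 5 * fps_X ^ 2 * sect 0 psi * sect 1 psi * dil 5 psi ^ 3"

lemma dil_five_products:
  "dil 5 phi * dil 5 (euler_f 2) = dil 5 (euler_f 1) ^ 2"
  "dil 5 psi * dil 5 (euler_f 1) = dil 5 (euler_f 2) ^ 2"
  using arg_cong[OF phi_mult, of "dil 5"] arg_cong[OF psi_mult, of "dil 5"] by simp_all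

text \<open>The components of \<open>phi * f_2 = f_1^2\<close> and \<open>psi * f_1 = f_2^2\<close>
  supply the linear hypotheses of \<open>quintic_relations\<close>; the two Hecke relations then
  bring in the powers of \<open>phi\<close> and \<open>psi\<close>.\<close>

lemma sect_identities:
  defines "U \<equiv> sect 0 (euler_f 1)" and "V \<equiv> dil 5 (euler_f 1)" and "W \<equiv> sect 2 (euler_f 1)"
    and "g \<equiv> dil 5 phi" and "D \<equiv> sect 1 phi" and "E \<equiv> sect 4 phi" and "p \<equiv> dil 5 psi"
  shows "(5 * V ^ 4 * (g ^ 2 + 2 * fps_X * D * E) + 2 * g * D * (3 * U * V ^ 3 + fps_X * W ^ 4)
      + D ^ 2 * (2 * U ^ 2 * V ^ 2 + fps_X * V * W ^ 3) + fps_X * E ^ 2 * (U ^ 3 * V + 2 * fps_X * V ^ 2 * W ^ 2)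
      + 2 * g * E * (U ^ 4 + 3 * fps_X * V ^ 3 * W)) * g ^ 2 = 5 * V ^ 4 * phi ^ 4"
    and "norm_euler * g ^ 4 * p ^ 2 = V ^ 5 * phi ^ 4 * psi ^ 2"
    and "p * norm_psi = psi ^ 6"
proof -
  define V2 U2 W2 A B where "V2 = dil 5 (euler_f 2)" and "U2 = sect 0 (euler_f 2)"
    and "W2 = - sect 4 (euler_f 2)" and "A = sect 0 psi" and "B = sect 1 psi"
  have W2: "sect 4 (euler_f 2) = - W2" by (simp add: W2_def)
  \<comment> \<open>The minus signs bring \<open>U * W = - (V ^ 2)\<close> and its dilation by 2
    into the form that \<open>quintic_relations\<close> needs.\<close>
  have UW: "U * (- W) = V ^ 2" "U2 * W2 = V2 ^ 2"
    using sect_euler_1_relation sect_euler_2_relation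
    by (simp_all add: U_def V_def W_def U2_def V2_def W2_def)
  have gp: "g * V2 = V ^ 2" "p * V = V2 ^ 2"
    using dil_five_products by (simp_all add: g_def p_def V_def V2_def)
  note folds = U_def[symmetric] V_def[symmetric] W_def[symmetric] g_def[symmetric] D_def[symmetric]
    E_def[symmetric] p_def[symmetric] V2_def[symmetric] U2_def[symmetric] A_def[symmetric] B_def[symmetric]
  have e1: "sect r (phi * euler_f 2) = sect r (euler_f 1 * euler_f 1)" for r
    using phi_mult by (simp add: power2_eq_square)
  have e2: "sect r (psi * euler_f 1) = sect r (euler_f 2 * euler_f 2)" for r
    using psi_mult by (simp add: power2_eq_square)
  have D: "D * U2 - fps_X * E * V2 = - 2 * U * V" "- D * V2 - fps_X * E * W2 = 2 * V * (- W)"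
      "E * U2 - g * W2 = (- W) ^ 2"
    using e1[of 1, unfolded sect_mult sect_phi sect_euler_1 sect_euler_2 W2, unfolded folds]
      e1[of 3, unfolded sect_mult sect_phi sect_euler_1 sect_euler_2 W2, unfolded folds]
      e1[of 4, unfolded sect_mult sect_phi sect_euler_1 sect_euler_2 W2, unfolded folds]
    by algebra+
  have A: "A * U - fps_X * p * (- W) = U2 ^ 2" "p * U - B * (- W) = fps_X * W2 ^ 2"
    using e2[of 0, unfolded sect_mult sect_psi sect_euler_1 sect_euler_2 W2, unfolded folds]
      e2[of 3, unfolded sect_mult sect_psi sect_euler_1 sect_euler_2 W2, unfolded folds]
    by algebra+
  have nz: "V \<noteq> 0" "V2 \<noteq> 0" "g \<noteq> 0" "p \<noteq> 0"
    unfolding V_def V2_def g_def p_def by (rule dil_neq_0; simp add: euler_f_nth_0)+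
  have W: "- W \<noteq> 0" "W2 \<noteq> 0" using UW nz by auto
  have two: "(2 :: int fps) \<noteq> 0" by simp
  have h: "phi ^ 2 = g ^ 2 + fps_X * D * E" and s: "psi ^ 2 = A * B + fps_X * p ^ 2"
    using phi_hecke psi_hecke by (simp_all only: folds)
  note R = quintic_relations[OF two nz(1) W(1) nz(2) W(2) nz(3,4) UW gp D A]
  show "(5 * V ^ 4 * (g ^ 2 + 2 * fps_X * D * E) + 2 * g * D * (3 * U * V ^ 3 + fps_X * W ^ 4)
      + D ^ 2 * (2 * U ^ 2 * V ^ 2 + fps_X * V * W ^ 3) + fps_X * E ^ 2 * (U ^ 3 * V + 2 * fps_X * V ^ 2 * W ^ 2)
      + 2 * g * E * (U ^ 4 + 3 * fps_X * V ^ 3 * W)) * g ^ 2 = 5 * V ^ 4 * phi ^ 4"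
    using R(1) h by algebra
  show "norm_euler * g ^ 4 * p ^ 2 = V ^ 5 * phi ^ 4 * psi ^ 2"
    unfolding norm_euler_def folds using R(2) h s by algebra
  show "p * norm_psi = psi ^ 6"
    unfolding norm_psi_def folds using R(3) s by algebra
qed

lemma phi_psi: "phi ^ 2 * psi = euler_f 1 ^ 3"
proof -
  have "(euler_f 1 * euler_f 2 ^ 2) * (phi ^ 2 * psi) = (euler_f 1 * euler_f 2 ^ 2) * euler_f 1 ^ 3"
    using phi_mult psi_mult by algebra
  moreover have "euler_f 1 * euler_f 2 ^ 2 \<noteq> 0" by simp
  ultimately show ?thesis by (rule mult_left_cancelD)
qed

text \<open>The relation \<open>phi_psi\<close> and its dilation by 5 eliminate \<open>phi\<close>
  and \<open>psi\<close> from the second claim of \<open>sect_identities\<close>.\<close>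

lemma norm_euler: "dil 5 (euler_f 1) * norm_euler = euler_f 1 ^ 6"
proof -
  define V where "V = dil 5 (euler_f 1)"
  have "dil 5 phi ^ 2 * dil 5 psi = V ^ 3"
    using arg_cong[OF phi_psi, of "dil 5"] by (simp add: V_def)
  hence "V ^ 5 * (V * norm_euler) = V ^ 5 * euler_f 1 ^ 6"
    using sect_identities(2) phi_psi unfolding V_def[symmetric] by algebra
  moreover have "V ^ 5 \<noteq> 0"
    unfolding V_def using dil_neq_0[of 5 "euler_f 1"] by (simp add: euler_f_nth_0)
  ultimately show ?thesis unfolding V_def by (rule mult_left_cancelD)
qed

text \<open>
  The cofactor \<open>Y\<close> is the product of the conjugates of the series under \<open>q \<mapsto> \<zeta> q\<close>, \<open>\<zeta>\<^sup>5 = 1\<close>, \<open>\<zeta> \<noteq> 1\<close>,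
  written in terms of the components of the series.
\<close>

lemma euler_cofactor:
  defines "U \<equiv> sect 0 (euler_f 1)" and "V \<equiv> dil 5 (euler_f 1)" and "W \<equiv> sect 2 (euler_f 1)"
  obtains Y where "euler_f 1 * Y = dil 5 norm_euler" "sect 0 Y = U ^ 4 + 3 * fps_X * V ^ 3 * W"
    "sect 1 Y = U ^ 3 * V + 2 * fps_X * V ^ 2 * W ^ 2" "sect 2 Y = 2 * U ^ 2 * V ^ 2 + fps_X * V * W ^ 3"
    "sect 3 Y = 3 * U * V ^ 3 + fps_X * W ^ 4" "sect 4 Y = 5 * V ^ 4"
proof -
  define Y where "Y = dil 5 (U ^ 4 + 3 * fps_X * V ^ 3 * W) +
    fps_X * (dil 5 (U ^ 3 * V + 2 * fps_X * V ^ 2 * W ^ 2) +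
    fps_X * (dil 5 (2 * U ^ 2 * V ^ 2 + fps_X * V * W ^ 3) +
    fps_X * (dil 5 (3 * U * V ^ 3 + fps_X * W ^ 4) + fps_X * dil 5 (5 * V ^ 4))))"
  have Y: "sect 0 Y = U ^ 4 + 3 * fps_X * V ^ 3 * W"
    "sect 1 Y = U ^ 3 * V + 2 * fps_X * V ^ 2 * W ^ 2" "sect 2 Y = 2 * U ^ 2 * V ^ 2 + fps_X * V * W ^ 3"
    "sect 3 Y = 3 * U * V ^ 3 + fps_X * W ^ 4" "sect 4 Y = 5 * V ^ 4"
    unfolding Y_def by (simp_all del: dil_add dil_mult dil_power dil_numeral_mult)
  have UW: "U * W = - (V ^ 2)"
    unfolding U_def V_def W_def by (rule sect_euler_1_relation)
  have "euler_f 1 * Y = dil 5 norm_euler"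
  proof (rule eq_dil_5)
    note folds = U_def[symmetric] V_def[symmetric] W_def[symmetric]
    show "sect 0 (euler_f 1 * Y) = norm_euler"
      unfolding sect_mult Y sect_euler_1 norm_euler_def folds using UW by algebra
    show "sect 1 (euler_f 1 * Y) = 0" "sect 2 (euler_f 1 * Y) = 0"
      "sect 3 (euler_f 1 * Y) = 0" "sect 4 (euler_f 1 * Y) = 0"
      unfolding sect_mult Y sect_euler_1 folds using UW by algebra+
  qed
  thus ?thesis using that Y by blast
qed

lemma psi_cofactor:
  defines "A \<equiv> sect 0 psi" and "B \<equiv> sect 1 psi" and "p \<equiv> dil 5 psi"
  obtains Y where "psi * Y = dil 5 norm_psi"
    "sect 2 Y = A ^ 2 * B ^ 2 - 3 * fps_X * A * B * p ^ 2 + fps_X ^ 2 * p ^ 4"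
proof -
  define Y0 Y1 Y2 Y3 Y4 where "Y0 = A ^ 4 + 2 * fps_X * A * B ^ 2 * p - fps_X ^ 2 * B * p ^ 3"
    and "Y1 = - (A ^ 3 * B) - fps_X * B ^ 3 * p + fps_X * A ^ 2 * p ^ 2"
    and "Y2 = A ^ 2 * B ^ 2 - 3 * fps_X * A * B * p ^ 2 + fps_X ^ 2 * p ^ 4"
    and "Y3 = - (A ^ 3 * p) - A * B ^ 3 + fps_X * B ^ 2 * p ^ 2"
    and "Y4 = B ^ 4 + 2 * A ^ 2 * B * p - fps_X * A * p ^ 3"
  define Y where "Y = dil 5 Y0 + fps_X * (dil 5 Y1 + fps_X * (dil 5 Y2 + fps_X * (dil 5 Y3 + fps_X * dil 5 Y4)))"
  have Y: "sect 0 Y = Y0" "sect 1 Y = Y1" "sect 2 Y = Y2" "sect 3 Y = Y3" "sect 4 Y = Y4"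
    unfolding Y_def by simp_all
  have "psi * Y = dil 5 norm_psi"
  proof (rule eq_dil_5)
    note folds = A_def[symmetric] B_def[symmetric] p_def[symmetric]
    note defs = Y0_def Y1_def Y2_def Y3_def Y4_def
    show "sect 0 (psi * Y) = norm_psi"
      unfolding sect_mult Y sect_psi norm_psi_def folds unfolding defs by algebra
    show "sect 1 (psi * Y) = 0" "sect 2 (psi * Y) = 0" "sect 3 (psi * Y) = 0" "sect 4 (psi * Y) = 0"
      unfolding sect_mult Y sect_psi folds unfolding defs by algebra+
  qed
  thus ?thesis using that Y(3) by (simp add: Y2_def)
qed

section \<open>Congruences\<close>

definition crank :: "int fps" where
  "crank = Abs_fps (\<lambda>n. C (int n))"

lemma crank_mult: "crank * euler_f 2 ^ 2 = euler_f 1 ^ 3"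
  unfolding crank_def by (rule C_gen_fun)

lemma crank_phi: "crank * euler_f 1 = phi ^ 2"
proof -
  have "euler_f 2 ^ 2 * (crank * euler_f 1) = euler_f 2 ^ 2 * phi ^ 2"
    using crank_mult phi_mult by algebra
  moreover have "euler_f 2 ^ 2 \<noteq> 0" by simp
  ultimately show ?thesis by (rule mult_left_cancelD)
qed

lemma crank_psi: "crank * psi ^ 2 = euler_f 1 * euler_f 2 ^ 2"
proof -
  have "(euler_f 1 ^ 2 * euler_f 2 ^ 2) * (crank * psi ^ 2) =
      (euler_f 1 ^ 2 * euler_f 2 ^ 2) * (euler_f 1 * euler_f 2 ^ 2)"
    using crank_mult psi_mult by algebra
  moreover have "euler_f 1 ^ 2 * euler_f 2 ^ 2 \<noteq> 0" by simp
  ultimately show ?thesis by (rule mult_left_cancelD)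
qed

text \<open>Since \<open>crank = phi^2 / f_1\<close>, multiplication by the norm replaces
  \<open>1 / f_1\<close> by the cofactor \<open>Y\<close>. Component 4 of \<open>phi^2 * Y\<close>
  is the bracket evaluated in \<open>sect_identities\<close>, where the factor 5 appears.\<close>

lemma sect_4_crank:
  "sect 4 crank * euler_f 2 ^ 4 = 5 * euler_f 1 ^ 2 * dil 5 (euler_f 1) * dil 5 (euler_f 2) ^ 2"
proof -
  define U V W g D E where "U = sect 0 (euler_f 1)" and "V = dil 5 (euler_f 1)" and "W = sect 2 (euler_f 1)"
    and "g = dil 5 phi" and "D = sect 1 phi" and "E = sect 4 phi"
  define V2 where "V2 = dil 5 (euler_f 2)"
  obtain Y where Y: "euler_f 1 * Y = dil 5 norm_euler" "sect 0 Y = U ^ 4 + 3 * fps_X * V ^ 3 * W"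
    "sect 1 Y = U ^ 3 * V + 2 * fps_X * V ^ 2 * W ^ 2" "sect 2 Y = 2 * U ^ 2 * V ^ 2 + fps_X * V * W ^ 3"
    "sect 3 Y = 3 * U * V ^ 3 + fps_X * W ^ 4" "sect 4 Y = 5 * V ^ 4"
    unfolding U_def V_def W_def by (rule euler_cofactor)
  define Z where "Z = sect 4 (phi * phi * Y)"
  have "crank * dil 5 norm_euler = crank * euler_f 1 * Y"
    unfolding Y(1)[symmetric] by (simp only: mult.assoc)
  hence "crank * dil 5 norm_euler = phi * phi * Y"
    unfolding crank_phi power2_eq_square .
  hence 1: "sect 4 crank * norm_euler = Z"
    unfolding Z_def using sect_mult_dil[of 4 crank norm_euler] by simp
  have Z: "Z = 5 * V ^ 4 * (g ^ 2 + 2 * fps_X * D * E) + 2 * g * D * (3 * U * V ^ 3 + fps_X * W ^ 4)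
      + D ^ 2 * (2 * U ^ 2 * V ^ 2 + fps_X * V * W ^ 3) + fps_X * E ^ 2 * (U ^ 3 * V + 2 * fps_X * V ^ 2 * W ^ 2)
      + 2 * g * E * (U ^ 4 + 3 * fps_X * V ^ 3 * W)"
    unfolding Z_def sect_mult Y sect_phi g_def[symmetric] D_def[symmetric] E_def[symmetric] by algebra
  have 2: "Z * g ^ 2 = 5 * V ^ 4 * phi ^ 4"
    unfolding Z unfolding U_def V_def W_def g_def D_def E_def by (rule sect_identities(1))
  have 3: "V * norm_euler = euler_f 1 ^ 6"
    unfolding V_def by (rule norm_euler)
  have 4: "g * V2 = V ^ 2"
    using dil_five_products(1) by (simp add: g_def V_def V2_def)
  have 5: "phi * euler_f 2 = euler_f 1 ^ 2" by (rule phi_mult)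
  have "sect 4 crank * euler_f 1 ^ 6 * g ^ 2 = V * ((sect 4 crank * norm_euler) * g ^ 2)"
    unfolding 3[symmetric] by (simp only: mult_ac)
  also have "\<dots> = 5 * V ^ 5 * phi ^ 4"
    unfolding 1 2 by algebra
  finally have "sect 4 crank * euler_f 1 ^ 6 * g ^ 2 = 5 * V ^ 5 * phi ^ 4" .
  hence "sect 4 crank * euler_f 1 ^ 6 * (g * V2) ^ 2 * euler_f 2 ^ 4 = 5 * V ^ 5 * (phi * euler_f 2) ^ 4 * V2 ^ 2"
    by algebra
  hence "(euler_f 1 ^ 6 * V ^ 4) * (sect 4 crank * euler_f 2 ^ 4)
      = (euler_f 1 ^ 6 * V ^ 4) * (5 * euler_f 1 ^ 2 * V * V2 ^ 2)"
    unfolding 4 5 by algebra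
  moreover have "euler_f 1 ^ 6 * V ^ 4 \<noteq> 0"
    unfolding V_def using dil_neq_0[of 5 "euler_f 1"] by (simp add: euler_f_nth_0)
  ultimately show ?thesis unfolding V_def V2_def by (rule mult_left_cancelD)
qed

section \<open>The reciprocal of \<open>psi\<close> and the return of the crank series\<close>

definition ipsi :: "int fps" where
  "ipsi = inv_fps psi"

lemma ipsi: "psi * ipsi = 1"
  unfolding ipsi_def by (rule inv_fps) simp

lemma sect_4_crank_psi: "sect 4 crank * psi = 5 * ipsi * dil 5 (euler_f 1) * dil 5 (euler_f 2) ^ 2"
proof -
  have "euler_f 2 ^ 4 * (sect 4 crank * psi) =
      euler_f 2 ^ 4 * (5 * ipsi * dil 5 (euler_f 1) * dil 5 (euler_f 2) ^ 2)"
    using sect_4_crank psi_mult ipsi by algebra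
  moreover have "euler_f 2 ^ 4 \<noteq> 0" by simp
  ultimately show ?thesis by (rule mult_left_cancelD)
qed

text \<open>By the cofactor, component 2 of \<open>1 / psi\<close> is
  \<open>sect 2 Y / norm_psi\<close>. Replacing \<open>A * B\<close> by
  \<open>psi ^ 2 - fps_X * p ^ 2\<close> produces the coefficients 5.\<close>

lemma sect_2_ipsi:
  defines "p \<equiv> dil 5 psi"
  shows "sect 2 ipsi = p * (ipsi ^ 2 - 5 * fps_X * p ^ 2 * ipsi ^ 4 + 5 * fps_X ^ 2 * p ^ 4 * ipsi ^ 6)"
proof -
  define A B where "A = sect 0 psi" and "B = sect 1 psi"
  obtain Y where Y: "psi * Y = dil 5 norm_psi"
    "sect 2 Y = A ^ 2 * B ^ 2 - 3 * fps_X * A * B * p ^ 2 + fps_X ^ 2 * p ^ 4"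
    unfolding A_def B_def p_def by (rule psi_cofactor)
  have s: "psi ^ 2 = A * B + fps_X * p ^ 2"
    unfolding A_def B_def p_def by (rule psi_hecke)
  have "ipsi * dil 5 norm_psi = (psi * ipsi) * Y"
    unfolding Y(1)[symmetric] by (simp only: mult_ac)
  hence "ipsi * dil 5 norm_psi = Y" by (simp add: ipsi)
  hence "sect 2 ipsi * norm_psi = sect 2 Y"
    using sect_mult_dil[of 2 ipsi norm_psi] by simp
  moreover have "p * norm_psi = psi ^ 6" unfolding p_def by (rule sect_identities(3))
  ultimately have "sect 2 ipsi * psi ^ 6 = p * (psi ^ 4 - 5 * fps_X * psi ^ 2 * p ^ 2 + 5 * fps_X ^ 2 * p ^ 4)"
    using s Y(2) by algebra
  thus ?thesis using ipsi by algebra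
qed

text \<open>The factor \<open>f_1 * f_2^2\<close> equals \<open>crank * psi ^ 2\<close>, so the
  crank series reappears.\<close>

lemma sect_2_sect_4:
  defines "p \<equiv> dil 5 psi"
  shows "sect 2 (sect 4 (crank * dil 5 psi)) =
    5 * (crank * p - 5 * (fps_X * (crank * ipsi ^ 2 * p ^ 3)) + 5 * (fps_X * (fps_X * (crank * ipsi ^ 4 * p ^ 5))))"
proof -
  have "sect 4 (crank * dil 5 psi) = 5 * (ipsi * dil 5 (euler_f 1 * euler_f 2 ^ 2))"
    by (simp add: sect_4_crank_psi mult.assoc)
  hence "sect 2 (sect 4 (crank * dil 5 psi)) = 5 * (sect 2 ipsi * (euler_f 1 * euler_f 2 ^ 2))"
    by (simp del: dil_mult)
  also have "\<dots> = 5 * (crank * p - 5 * (fps_X * (crank * ipsi ^ 2 * p ^ 3)) + 5 * (fps_X * (fps_X * (crank * ipsi ^ 4 * p ^ 5))))"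
    unfolding sect_2_ipsi p_def[symmetric] crank_psi[symmetric] using ipsi by algebra
  finally show ?thesis .
qed

text \<open>Frobenius modulo 5, with Fermat's theorem for the constant coefficient. Splitting off
  that coefficient reduces index \<open>n\<close> to index \<open>n - 5\<close> of the shifted
  series, so the induction varies \<open>f\<close>.\<close>

lemma power_5_cong: "5 dvd f ^ 5 - dil 5 f" for f :: "int fps"
proof -
  have "5 dvd fps_nth (f ^ 5 - dil 5 f) n" for n and f :: "int fps"
  proof (induction n arbitrary: f rule: less_induct)
    case (less n)
    define c g where "c = fps_nth f 0" and "g = fps_shift 1 f"
    have f: "f = fps_const c + fps_X * g"
      unfolding c_def g_def by (auto simp: fps_eq_iff)
    define h where "h = fps_const c ^ 4 * (fps_X * g) + 2 * fps_const c ^ 3 * (fps_X * g) ^ 2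
      + 2 * fps_const c ^ 2 * (fps_X * g) ^ 3 + fps_const c * (fps_X * g) ^ 4"
    have p: "f ^ 5 = fps_const (c ^ 5) + fps_X ^ 5 * g ^ 5 + 5 * h"
      unfolding f h_def fps_const_power[symmetric] by algebra
    have "fps_const c = fps_const c * 1" "fps_X * g = fps_X ^ 1 * g" by simp_all
    hence d: "dil 5 f = fps_const c + fps_X ^ 5 * dil 5 g"
      using dil_fps_const_mult[of 5 c 1] dil_X_power[of 5 1] unfolding f by simp
    have e: "f ^ 5 - dil 5 f = fps_const (c ^ 5 - c) + fps_X ^ 5 * (g ^ 5 - dil 5 g) + 5 * h"
      unfolding p d fps_const_sub[symmetric] by algebra
    have "c mod 5 \<in> {0, 1, 2, 3, 4}" by auto
    hence "((c mod 5) ^ 5 mod 5 - c mod 5) mod 5 = 0" by auto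
    hence "(c ^ 5 - c) mod 5 = 0" by (simp only: power_mod mod_diff_eq)
    hence "5 dvd c ^ 5 - c" by presburger
    moreover have "5 dvd fps_nth (fps_X ^ 5 * (g ^ 5 - dil 5 g)) n"
      using less.IH[of "n - 5" g] by (cases "n < 5") (simp_all add: fps_X_power_mult_nth)
    moreover have "5 dvd fps_nth (5 * h) n" by (simp add: fps_numeral_fps_const)
    ultimately show ?case unfolding e fps_add_nth by (intro dvd_add) auto
  qed
  thus ?thesis by (simp only: fps_numeral_dvd_iff simp_thms)
qed

text \<open>In \<open>f_1 * f_1^3\<close> the classes 0, 1, 2 meet 0, 1, 3, and 4 arises only as 1 +
  3. Doubling the exponents moves class 4 to class 3.\<close>

lemma five_dvd_sect_euler_2_power_4: "5 dvd sect 3 (euler_f 2 ^ 4)"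
proof -
  have "sect 4 (euler_f 1 ^ 4) = sect 4 (euler_f 1 * euler_f 1 ^ 3)"
    by (simp add: power_Suc[symmetric] del: power_Suc)
  also have "\<dots> = - dil 5 (euler_f 1) * sect 3 (euler_f 1 ^ 3)"
    by (simp add: sect_mult(5) sect_euler_1 sect_cube)
  finally have "5 dvd sect 4 (euler_f 1 ^ 4)"
    using five_dvd_sect_cube by (simp add: dvd_mult)
  then obtain k where "sect 4 (euler_f 1 ^ 4) = 5 * k" ..
  hence "sect 3 (dil 2 (euler_f 1 ^ 4)) = 5 * (fps_X * dil 2 k)"
    by (simp add: sect_dil_2 del: dil_power)
  thus ?thesis by (simp add: euler_f_2)
qed

lemma sect_2_euler_square: "sect 2 (euler_f 1 ^ 2) = - (dil 5 (euler_f 1) ^ 2)"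
proof -
  have "sect 2 (euler_f 1 ^ 2) = 2 * (sect 0 (euler_f 1) * sect 2 (euler_f 1)) + dil 5 (euler_f 1) ^ 2"
    by (simp add: power2_eq_square sect_mult sect_euler_1 mult.commute)
  thus ?thesis unfolding sect_euler_1_relation by simp
qed

lemma dvd_trans_diff: "(m :: int fps) dvd x - y \<Longrightarrow> m dvd y - z \<Longrightarrow> m dvd x - z"
  using dvd_add[of m "x - y" "y - z"] by simp

text \<open>One 5 is explicit in \<open>sect_2_sect_4\<close>, a second in
  \<open>sect_4_crank_psi\<close> and in the corrections. The third is a congruence modulo 5: the
  middle term vanishes and the last cancels the first.\<close>

lemma sect_4_sect_2_sect_4: "125 dvd sect 4 (sect 2 (sect 4 (crank * dil 5 psi)))"
proof -
  define p V V2 where "p = dil 5 psi" and "V = dil 5 (euler_f 1)" and "V2 = dil 5 (euler_f 2)"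
  define J where "J = inv_fps (euler_f 2)"
  have J: "euler_f 2 * J = 1" unfolding J_def by (rule inv_fps) (simp add: euler_f_nth_0)
  have I: "ipsi = euler_f 1 * J ^ 2"
    using ipsi psi_mult J by algebra
  have c: "crank = euler_f 1 ^ 3 * J ^ 2"
    using crank_mult J by algebra
  have pV: "p * V = V2 ^ 2" using dil_five_products(2) by (simp add: p_def V_def V2_def)
  \<comment> \<open>The first product is \<open>ipsi ^ 5\<close>, which both corrections contain:
    \<open>crank * ipsi ^ 2 = ipsi ^ 5 * f_2^4\<close> and
    \<open>crank * ipsi ^ 4 = ipsi ^ 5 * f_1^2\<close>.\<close>
  have 5: "5 dvd euler_f 1 ^ 5 * (J ^ 5) ^ 2 - dil 5 (euler_f 1) * dil 5 J ^ 2"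
    unfolding power2_eq_square by (intro dvd_diff_mult power_5_cong)
  have I5: "dil 5 (euler_f 1) * dil 5 J ^ 2 = dil 5 ipsi" by (simp add: I)
  have "5 dvd euler_f 1 ^ 5 * (J ^ 5) ^ 2 * euler_f 2 ^ 4 - dil 5 ipsi * euler_f 2 ^ 4"
    using dvd_mult2[OF 5, of "euler_f 2 ^ 4"] unfolding I5 by (simp add: left_diff_distrib)
  moreover have "euler_f 1 ^ 5 * (J ^ 5) ^ 2 * euler_f 2 ^ 4 = crank * ipsi ^ 2"
    unfolding I c using J by algebra
  ultimately have "5 dvd sect 3 (crank * ipsi ^ 2 - dil 5 ipsi * euler_f 2 ^ 4)"
    by (intro sect_dvd) simp
  moreover have "sect 3 (crank * ipsi ^ 2 - dil 5 ipsi * euler_f 2 ^ 4)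
      = sect 3 (crank * ipsi ^ 2) - ipsi * sect 3 (euler_f 2 ^ 4)"
    by simp
  ultimately have "5 dvd (sect 3 (crank * ipsi ^ 2) - ipsi * sect 3 (euler_f 2 ^ 4)) + ipsi * sect 3 (euler_f 2 ^ 4)"
    using five_dvd_sect_euler_2_power_4 by (intro dvd_add) simp_all
  hence t2: "5 dvd sect 3 (crank * ipsi ^ 2)" by simp
  have "5 dvd euler_f 1 ^ 5 * (J ^ 5) ^ 2 * euler_f 1 ^ 2 - dil 5 ipsi * euler_f 1 ^ 2"
    using dvd_mult2[OF 5, of "euler_f 1 ^ 2"] unfolding I5 by (simp add: left_diff_distrib)
  moreover have "euler_f 1 ^ 5 * (J ^ 5) ^ 2 * euler_f 1 ^ 2 = crank * ipsi ^ 4"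
    unfolding I c by algebra
  ultimately have "5 dvd sect 2 (crank * ipsi ^ 4 - dil 5 ipsi * euler_f 1 ^ 2)"
    by (intro sect_dvd) simp
  hence t3: "5 dvd sect 2 (crank * ipsi ^ 4) - (- (ipsi * V ^ 2))"
    by (simp add: sect_2_euler_square V_def)
  \<comment> \<open>Here \<open>psi ^ 5\<close> becomes \<open>p\<close>, and
    \<open>p * V = V2 ^ 2\<close> turns the value into the negative of
    \<open>ipsi * V * V2 ^ 2\<close>.\<close>
  have "5 dvd psi ^ 5 * sect 2 (crank * ipsi ^ 4) - p * (- (ipsi * V ^ 2))"
    unfolding p_def by (intro dvd_diff_mult power_5_cong t3)
  moreover have "5 dvd psi ^ 3 * sect 3 (crank * ipsi ^ 2)" using t2 by (rule dvd_mult)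
  ultimately have "5 dvd (psi ^ 5 * sect 2 (crank * ipsi ^ 4) - p * (- (ipsi * V ^ 2)))
      - psi ^ 3 * sect 3 (crank * ipsi ^ 2)" by (rule dvd_diff)
  also have "\<dots> = ipsi * V * V2 ^ 2 - psi ^ 3 * sect 3 (crank * ipsi ^ 2) + psi ^ 5 * sect 2 (crank * ipsi ^ 4)"
    using pV by algebra
  finally obtain k where k:
    "ipsi * V * V2 ^ 2 - psi ^ 3 * sect 3 (crank * ipsi ^ 2) + psi ^ 5 * sect 2 (crank * ipsi ^ 4) = 5 * k" ..
  have pp: "p ^ n = dil 5 (psi ^ n)" for n by (simp add: p_def)
  have e: "sect 2 (sect 4 (crank * dil 5 psi)) = 5 * (crank * p - 5 * (fps_X * (crank * ipsi ^ 2 * p ^ 3))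
      + 5 * (fps_X * (fps_X * (crank * ipsi ^ 4 * p ^ 5))))"
    unfolding p_def by (rule sect_2_sect_4)
  have "sect 4 (sect 2 (sect 4 (crank * dil 5 psi))) = 5 * (sect 4 crank * psi
      - 5 * (sect 3 (crank * ipsi ^ 2) * psi ^ 3) + 5 * (sect 2 (crank * ipsi ^ 4) * psi ^ 5))"
    unfolding e pp unfolding p_def by (simp del: dil_power)
  also have "\<dots> = 5 * (5 * (5 * k))"
    unfolding sect_4_crank_psi V_def[symmetric] V2_def[symmetric] k[symmetric] by algebra
  finally show ?thesis by simp
qed

section \<open>The reciprocal series and the first congruence\<close>

definition crank_inv :: "int fps" where
  "crank_inv = Abs_fps (\<lambda>n. a (int n))"

lemma sect_3_sect_1: "5 dvd sect 3 (sect 1 (crank_inv * dil 5 psi))"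
proof -
  define J where "J = inv_fps (euler_f 1)"
  have J: "euler_f 1 * J = 1" unfolding J_def by (rule inv_fps) (simp add: euler_f_nth_0)
  have "crank_inv * euler_f 1 ^ 3 = euler_f 2 ^ 2"
    unfolding crank_inv_def by (rule a_gen_fun)
  \<comment> \<open>The quotient is expanded to \<open>psi * f_1^3 / f_1^5\<close>, so that the
    reciprocal is a fifth power and \<open>power_5_cong\<close> applies.\<close>
  hence c: "crank_inv = psi * euler_f 1 ^ 3 * J ^ 5"
    using psi_mult J by algebra
  have "5 dvd crank_inv - psi * euler_f 1 ^ 3 * dil 5 J"
    unfolding c right_diff_distrib[symmetric] by (intro dvd_mult power_5_cong)
  hence "5 dvd sect 1 (crank_inv - psi * euler_f 1 ^ 3 * dil 5 J)" by (rule sect_dvd)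
  hence "5 dvd sect 1 crank_inv - sect 1 (psi * euler_f 1 ^ 3) * J" by simp
  moreover have "5 dvd sect 1 (psi * euler_f 1 ^ 3) * J - (- 2 * (psi * euler_f 1 ^ 3)) * J"
    using dvd_mult2[OF psi_cube_hecke, of J] by (simp add: algebra_simps)
  ultimately have "5 dvd sect 1 crank_inv - (- 2 * (psi * euler_f 1 ^ 3)) * J"
    by (rule dvd_trans_diff)
  hence "5 dvd (sect 1 crank_inv - (- 2 * (psi * euler_f 1 ^ 3)) * J) * psi" by (rule dvd_mult2)
  also have "\<dots> = sect 1 (crank_inv * dil 5 psi) - (- (2 * euler_f 2 ^ 4))"
    using psi_mult J by simp algebra
  finally have "5 dvd sect 3 (sect 1 (crank_inv * dil 5 psi) - (- (2 * euler_f 2 ^ 4)))" by (rule sect_dvd)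
  hence "5 dvd sect 3 (sect 1 (crank_inv * dil 5 psi)) - (- (2 * sect 3 (euler_f 2 ^ 4)))"
    by (simp del: sect_mult_dil)
  moreover have "5 dvd - (2 * sect 3 (euler_f 2 ^ 4)) - 0"
    using five_dvd_sect_euler_2_power_4 by simp
  ultimately have "5 dvd sect 3 (sect 1 (crank_inv * dil 5 psi)) - 0" by (rule dvd_trans_diff)
  thus ?thesis by simp
qed

section \<open>Triangular sums as coefficients\<close>

lemma psi_nth:
  assumes "j \<le> N"
  shows "fps_nth psi j = (\<Sum>k\<le>N. if k * (k + 1) div 2 = j then 1 else 0)"
proof -
  define K where "K = {k :: nat. k * (k + 1) = 2 * j}"
  have K: "finite K" "K \<subseteq> {..N}"
  proof -
    have "k \<le> N" if "k \<in> K" for k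
    proof (cases k)
      case (Suc m)
      hence "k * 2 \<le> k * (k + 1)" by (intro mult_left_mono) auto
      also have "k * (k + 1) = 2 * j" using that by (simp only: K_def mem_Collect_eq)
      finally show ?thesis using assms by linarith
    qed simp
    thus "K \<subseteq> {..N}" by blast
    thus "finite K" by (rule finite_subset) simp
  qed
  \<comment> \<open>Each triangular number is reached twice, from \<open>k + 1\<close> and from
    \<open>- k\<close>; this matches the factor 2 in \<open>psi_theta\<close>.\<close>
  have "{i. texp 0 1 i = j} = (\<lambda>k. int k + 1) ` K \<union> (\<lambda>k. - int k) ` K"
  proof (intro equalityI subsetI)
    fix i assume "i \<in> {i. texp 0 1 i = j}"
    hence i: "i * (i - 1) = 2 * int j" using texp[of 0 1 i] by simp
    show "i \<in> (\<lambda>k. int k + 1) ` K \<union> (\<lambda>k. - int k) ` K"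
    proof (cases "i > 0")
      case True
      then obtain k where k: "i = int k + 1" by (metis add.commute zless_iff_Suc_zadd of_nat_Suc add_0)
      have "int (k * (k + 1)) = int (2 * j)" using i by (simp add: k algebra_simps)
      hence "k \<in> K" unfolding K_def of_nat_eq_iff by simp
      thus ?thesis using k by blast
    next
      case False
      then obtain k where k: "i = - int k" by (metis nonpos_int_cases not_less)
      have "int (k * (k + 1)) = int (2 * j)" using i by (simp add: k algebra_simps)
      hence "k \<in> K" unfolding K_def of_nat_eq_iff by simp
      thus ?thesis using k by blast
    qed
  next
    fix i assume "i \<in> (\<lambda>k. int k + 1) ` K \<union> (\<lambda>k. - int k) ` K"
    then obtain k where k: "k * (k + 1) = 2 * j" "i = int k + 1 \<or> i = - int k"
      by (auto simp: K_def)
    have "i * (i - 1) = int (k * (k + 1))" using k(2) by (auto simp: algebra_simps)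
    hence "2 * int (texp 0 1 i) = 2 * int j" unfolding k(1) using texp[of 0 1 i] by simp
    thus "i \<in> {i. texp 0 1 i = j}" by simp
  qed
  moreover have "card ((\<lambda>k. int k + 1) ` K \<union> (\<lambda>k. - int k) ` K) = card K + card K"
    using K(1) by (subst card_Un_disjoint) (auto simp: card_image inj_on_def)
  ultimately have "card {i. texp 0 1 i = j} = 2 * card K" by simp
  hence "2 * fps_nth psi j = 2 * int (card K)"
    using arg_cong[OF psi_theta, of "\<lambda>f. fps_nth f j"]
    by (simp add: theta_def tsgn_def fps_numeral_fps_const)
  moreover have "(\<Sum>k\<le>N. if k * (k + 1) div 2 = j then 1 else 0) = int (card ({..N} \<inter> K))"
  proof -
    have "k * (k + 1) div 2 = j \<longleftrightarrow> k \<in> K" for k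
    proof -
      have "even (k * (k + 1))" by simp
      thus ?thesis unfolding K_def by auto
    qed
    thus ?thesis by (simp add: sum.If_cases)
  qed
  ultimately show ?thesis using K(2) by (simp add: Int_absorb1)
qed

text \<open>The shift is 5 times a triangular number, so the sum is a convolution with
  \<open>dil 5 psi\<close>; shifts beyond \<open>N\<close> contribute 0 by the hypothesis on
  \<open>u\<close>.\<close>

lemma triangular_sum:
  fixes u :: "int \<Rightarrow> int"
  assumes u: "\<And>i. i < 0 \<Longrightarrow> u i = 0"
  shows "(\<Sum>k. u (int N - 5 * int k * (int k + 1) div 2)) = fps_nth (Abs_fps (\<lambda>n. u (int n)) * dil 5 psi) N"
proof -
  define t where "t k = k * (k + 1) div 2" for k :: nat
  have t: "5 * int k * (int k + 1) div 2 = 5 * int (t k)" for k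
  proof -
    have "even (k * (k + 1))" by simp
    then obtain m where m: "k * (k + 1) = 2 * m" by (elim evenE)
    hence "int (k * (k + 1)) = 2 * int m" by simp
    hence "5 * int k * (int k + 1) = 2 * (5 * int m)" by (simp add: algebra_simps)
    thus ?thesis using m by (simp add: t_def)
  qed
  have "fps_nth (Abs_fps (\<lambda>n. u (int n)) * dil 5 psi) N = (\<Sum>j\<le>N div 5. fps_nth psi j * u (int (N - 5 * j)))"
    by (subst mult.commute) (simp add: dil_mult_nth)
  also have "\<dots> = (\<Sum>j\<le>N div 5. \<Sum>k\<le>N. if t k = j then u (int (N - 5 * j)) else 0)"
  proof (intro sum.cong refl)
    fix j assume "j \<in> {..N div 5}"
    hence "j \<le> N" by auto
    thus "fps_nth psi j * u (int (N - 5 * j)) = (\<Sum>k\<le>N. if t k = j then u (int (N - 5 * j)) else 0)"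
      by (subst psi_nth) (auto simp: sum_distrib_right t_def intro!: sum.cong)
  qed
  also have "\<dots> = (\<Sum>k\<le>N. \<Sum>j\<le>N div 5. if t k = j then u (int (N - 5 * j)) else 0)"
    by (rule sum.swap)
  also have "\<dots> = (\<Sum>k\<le>N. u (int N - 5 * int (t k)))"
  proof (intro sum.cong refl)
    fix k
    show "(\<Sum>j\<le>N div 5. if t k = j then u (int (N - 5 * j)) else 0) = u (int N - 5 * int (t k))"
    proof (cases "5 * t k \<le> N")
      case True
      hence "t k \<le> N div 5" "int (N - 5 * t k) = int N - 5 * int (t k)" by (auto simp: of_nat_diff)
      thus ?thesis by simp
    next
      case False
      hence "\<not> t k \<le> N div 5" "int N - 5 * int (t k) < 0" by auto
      thus ?thesis by (simp add: u)
    qed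
  qed
  finally show ?thesis
    using suminf_triangular_shift[OF u, where N = N] by (simp add: t)
qed

theorem theorem1p5:
  fixes n :: nat
  shows "[(\<Sum>k::nat. a (25 * int n + 16 - 5 * int k * (int k + 1) div 2)) = 0] (mod 5)
    \<and> (5 dvd (\<Sum>k::nat. C (125 * int n + 114 - 5 * int k * (int k + 1) div 2))
       \<and> [(\<Sum>k::nat. C (125 * int n + 114 - 5 * int k * (int k + 1) div 2)) div 5 = 0] (mod 25))"
proof -
  have "(\<Sum>k::nat. a (25 * int n + 16 - 5 * int k * (int k + 1) div 2))
      = fps_nth (crank_inv * dil 5 psi) (25 * n + 16)"
    using triangular_sum[of a "25 * n + 16"] by (simp add: a_def crank_inv_def)
  \<comment> \<open>Here \<open>25 * n + 16 = 5 * (5 * n + 3) + 1\<close>.\<close>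
  also have "\<dots> = fps_nth (sect 3 (sect 1 (crank_inv * dil 5 psi))) n"
    by (simp only: sect_nth) (simp add: algebra_simps)
  finally have "5 dvd (\<Sum>k::nat. a (25 * int n + 16 - 5 * int k * (int k + 1) div 2))"
    using sect_3_sect_1 by (simp only: fps_numeral_dvd_iff)
  moreover have "(\<Sum>k::nat. C (125 * int n + 114 - 5 * int k * (int k + 1) div 2))
      = fps_nth (crank * dil 5 psi) (125 * n + 114)"
    using triangular_sum[of C "125 * n + 114"] by (simp add: C_def crank_def)
  \<comment> \<open>Here \<open>125 * n + 114 = 5 * (5 * (5 * n + 4) + 2) + 4\<close>.\<close>
  moreover have "\<dots> = fps_nth (sect 4 (sect 2 (sect 4 (crank * dil 5 psi)))) n"
    by (simp only: sect_nth) (simp add: algebra_simps)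
  moreover have "125 dvd \<dots>"
    using sect_4_sect_2_sect_4 by (simp only: fps_numeral_dvd_iff)
  ultimately show ?thesis
    by (auto simp: cong_0_iff elim!: dvdE)
qed

end
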